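(* Let $V$ be a vector space over a field $\mathbb{K}$, $N\ge 1$, $a\in\mathbb{K}^N$, and let $F_1,\ldots,F_N$ be endomorphisms of $V$ making $V$ a module over the Lie algebra $\mathfrak{g}_a$ via $\epsilon_i.v=F_i(v)$. Then, on $S(\mathfrak{g}'_a)$, the products $\circledast$ (coming from the post-Lie product $*$) and $\odot$ (coming from the pre-Lie product $\bullet$), defined in the context, are equal: $\circledast=\odot$.
   Context: $(\epsilon_1,\ldots,\epsilon_N)$ is the canonical basis of $\mathbb{K}^N$; $\mathfrak{g}_a=\mathbb{K}^N$ with Lie bracket $[\epsilon_i,\epsilon_j]_a=a_j\epsilon_i-a_i\epsilon_j$. $T(V)$ has empty word $\emptyset$ and shuffle product $sh$. Elements of $T(V)^N$ are written $f_1\epsilon_1+\ldots+f_N\epsilon_N$. For $f,g\in T(V)$, $x\in V$: $f\epsilon_i\;{}_a sh\;g\epsilon_j=a_i(f\,sh\,g)\epsilon_j$ (associative); ${}_a[f\epsilon_i,g\epsilon_j]=(f\,sh\,g)(a_i\epsilon_j-a_j\epsilon_i)$; $*$ on $T(V)^N$ is defined inductively by $\emptyset\epsilon_i*g\epsilon_j=0$, $(xf)\epsilon_i*g\epsilon_j=x(f\epsilon_i*g\epsilon_j)+F_j(x)(f\,sh\,g)\epsilon_i$; and $u\bullet v=u*v+u\;{}_a sh\;v$. Under the module hypothesis $\mathfrak{g}'_a=(T(V)^N,{}_a[-,-],* )$ is a (right) post-Lie algebra and $(T(V)^N,\bullet)$ is a (right) pre-Lie algebra, i.e. $u*{}_a[v,w]=(u*v)*w-u*(v*w)-(u*w)*v+u*(w*v)$,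 ${}_a[u,v]*w={}_a[u*w,v]+{}_a[u,v*w]$ and $(u\bullet v)\bullet w-u\bullet(v\bullet w)=(u\bullet w)\bullet v-u\bullet(w\bullet v)$. Let $S=S(\mathfrak{g}'_a)$, with commutative product written by juxtaposition, usual coproduct $\Delta$ (elements of $\mathfrak{g}'_a$ primitive; Sweedler notation) and counit $\varepsilon$. It has a second associative product $$x_1\ldots x_k\blacktriangleleft y_1\ldots y_l=\sum_{I\subseteq\{1,\ldots,l\}}\ \sum_{\theta:I\hookrightarrow\{1,\ldots,k\}}\left(\prod_{i\notin \mathrm{Im}(\theta)}x_i\right)\left(\prod_{j\notin I}y_j\right)\left(\prod_{i\in I}x_{\theta(i)}\;{}_a sh\;y_i\right),$$ and $(S,\blacktriangleleft,\Delta)\cong\mathcal{U}(\mathfrak{g}'_a,{}_a[-,-])$. Extension of $*$: the unique bilinear extension to $S$ such that for $F,G,H\in S$, $y\in\mathfrak{g}'_a$: $F*1=F$; $1*F=\varepsilon(F)1$; $F*(G\blacktriangleleft y)=(F*G)*y-F*(G*y)$; $(F\blacktriangleleft G)*H=\sum(F*H^{(1)})\blacktriangleleft(G*H^{(2)})$. Then $F\circledast G:=\sum(F*G^{(1)})\blacktriangleleft G^{(2)}$. Extension of $\bullet$: the unique bilinear extension to $S$ such that: $F\bullet 1=F$; $1\bullet F=\varepsilon(F)1$; $F\bullet(Gy)=(F\bullet G)\bullet y-F\bullet(G\bullet y)$; $(FG)\bullet H=\sum(F\bullet H^{(1)})(G\bullet H^{(2)})$. Then $F\odot G:=\sum(F\bullet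 G^{(1)})G^{(2)}$. Both $(S,\circledast,\Delta)$ and $(S,\odot,\Delta)$ are Hopf algebras. *)

theory Defs
  imports Complex_Main "HOL-Library.Poly_Mapping" "HOL-Library.Multiset"
    "HOL-Library.FuncSet" "HOL-Library.Product_Plus" "HOL-Combinatorics.Permutations"
begin

section \<open>Free vector spaces and linear extension\<close>

abbreviation gen :: "'a \<Rightarrow> ('a, 'k::zero_neq_one) poly_mapping" where
  "gen x \<equiv> Poly_Mapping.single x 1"

definition pscale :: "'k::field \<Rightarrow> ('a, 'k) poly_mapping \<Rightarrow> ('a, 'k) poly_mapping" where
  "pscale c p = Poly_Mapping.map ((*) c) p"

definition lin_ext ::
    "('a \<Rightarrow> ('b, 'k::field) poly_mapping) \<Rightarrow> ('a, 'k) poly_mapping \<Rightarrow> ('b, 'k) poly_mapping" where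
  "lin_ext f p = (\<Sum>x\<in>Poly_Mapping.keys p. pscale (Poly_Mapping.lookup p x) (f x))"

definition bilin_ext ::
    "('a \<Rightarrow> 'b \<Rightarrow> ('c, 'k::field) poly_mapping) \<Rightarrow>
      ('a, 'k) poly_mapping \<Rightarrow> ('b, 'k) poly_mapping \<Rightarrow> ('c, 'k) poly_mapping" where
  "bilin_ext f p q = lin_ext (\<lambda>x. lin_ext (f x) q) p"


section \<open>Modules over the Lie algebra \<open>\<gg>\<^sub>a\<close>\<close>

text \<open>
  The index set \<open>{1..N}\<close>, \<open>N \<ge> 1\<close>, is an arbitrary finite type \<open>'n\<close>, and the space of
  \<open>N\<close>-tuples of scalars is \<open>'n \<Rightarrow> 'k\<close>. The bracket is the bilinear extension of
  \<open>[\<epsilon>\<^sub>i, \<epsilon>\<^sub>j] = a\<^sub>j \<epsilon>\<^sub>i - a\<^sub>i \<epsilon>\<^sub>j\<close>.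
\<close>

definition eps :: "'n \<Rightarrow> 'n \<Rightarrow> 'k::field" where
  "eps i = (\<lambda>k. if k = i then 1 else 0)"

definition ga_bracket :: "('n::finite \<Rightarrow> 'k::field) \<Rightarrow> ('n \<Rightarrow> 'k) \<Rightarrow> ('n \<Rightarrow> 'k) \<Rightarrow> 'n \<Rightarrow> 'k" where
  "ga_bracket a u v =
    (\<lambda>k. \<Sum>i\<in>UNIV. \<Sum>j\<in>UNIV. u i * v j * (a j * eps i k - a i * eps j k))"

definition ga_act ::
    "('k::field \<Rightarrow> 'v::ab_group_add \<Rightarrow> 'v) \<Rightarrow> ('n::finite \<Rightarrow> 'v \<Rightarrow> 'v) \<Rightarrow> ('n \<Rightarrow> 'k) \<Rightarrow> 'v \<Rightarrow> 'v" where
  "ga_act scale F u x = (\<Sum>i\<in>UNIV. scale (u i) (F i x))"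

definition ga_module ::
    "('k::field \<Rightarrow> 'v::ab_group_add \<Rightarrow> 'v) \<Rightarrow> ('n::finite \<Rightarrow> 'k) \<Rightarrow> ('n \<Rightarrow> 'v \<Rightarrow> 'v) \<Rightarrow> bool" where
  "ga_module scale a F \<longleftrightarrow>
    (\<forall>u v x. ga_act scale F (ga_bracket a u v) x =
      ga_act scale F u (ga_act scale F v x) - ga_act scale F v (ga_act scale F u x))"


section \<open>Tensors, the space \<open>T(V)\<^sup>N\<close> and its symmetric algebra\<close>

text \<open>
  \<open>T(V)\<close> is the free vector space on words in vectors of \<open>V\<close> modulo multilinearity of words in
  each letter. \<open>T(V)\<^sup>N\<close> is likewise the free vector space on pairs \<open>(w, i)\<close>, standing for
  \<open>w \<epsilon>\<^sub>i\<close>, modulo the same relations, and hence \<open>S(T(V)\<^sup>N)\<close> is the polynomial algebra in the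
  symbols \<open>(w, i)\<close> modulo the ideal generated by these relations. As the relations depend on the
  scalar multiplication of \<open>V\<close>, we do not form the quotient type: elements of \<open>T(V)\<close>,
  \<open>T(V)\<^sup>N\<close> and \<open>S(T(V)\<^sup>N)\<close> are given by representatives in the types below, and
  \<open>sym_eq\<close> is equality in \<open>S(T(V)\<^sup>N)\<close>. The commutative product and the unit of
  \<open>S(T(V)\<^sup>N)\<close> are those of the polynomial algebra \<open>sym\<close>.
\<close>

type_synonym ('v, 'k) tens = "('v list, 'k) poly_mapping"
type_synonym ('v, 'n, 'k) tensN = "('v list \<times> 'n, 'k) poly_mapping"
type_synonym ('v, 'n, 'k) sym = "(('v list \<times> 'n) multiset, 'k) poly_mapping"

definition incl :: "('v, 'n, 'k::field) tensN \<Rightarrow> ('v, 'n, 'k) sym" where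
  "incl = lin_ext (\<lambda>g. gen {#g#})"

inductive_set multilin_ideal ::
    "('k::field \<Rightarrow> 'v::ab_group_add \<Rightarrow> 'v) \<Rightarrow> ('v, 'n, 'k) sym set"
  for scale :: "'k \<Rightarrow> 'v \<Rightarrow> 'v" where
  additive: "incl (gen (u @ (x + y) # w, i) - gen (u @ x # w, i) - gen (u @ y # w, i))
      \<in> multilin_ideal scale"
| homogeneous: "incl (gen (u @ scale c x # w, i) - pscale c (gen (u @ x # w, i)))
      \<in> multilin_ideal scale"
| add: "P \<in> multilin_ideal scale \<Longrightarrow> Q \<in> multilin_ideal scale \<Longrightarrow> P + Q \<in> multilin_ideal scale"
| mult: "P \<in> multilin_ideal scale \<Longrightarrow> R * P \<in> multilin_ideal scale"

definition sym_eq ::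
    "('k::field \<Rightarrow> 'v::ab_group_add \<Rightarrow> 'v) \<Rightarrow> ('v, 'n, 'k) sym \<Rightarrow> ('v, 'n, 'k) sym \<Rightarrow> bool" where
  "sym_eq scale P Q \<longleftrightarrow> P - Q \<in> multilin_ideal scale"

text \<open>
  The set-valued library function \<open>shuffles\<close> forgets multiplicities, so it does not describe
  the shuffle product.
\<close>

fun sh_word :: "'v list \<Rightarrow> 'v list \<Rightarrow> ('v, 'k::field) tens" where
  "sh_word [] v = gen v"
| "sh_word u [] = gen u"
| "sh_word (x # u) (y # v) =
    lin_ext (\<lambda>w. gen (x # w)) (sh_word u (y # v)) + lin_ext (\<lambda>w. gen (y # w)) (sh_word (x # u) v)"

fun ash_word :: "('n \<Rightarrow> 'k::field) \<Rightarrow> 'v list \<times> 'n \<Rightarrow> 'v list \<times> 'n \<Rightarrow> ('v, 'n, 'k) tensN" where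
  "ash_word a (f, i) (g, j) = pscale (a i) (lin_ext (\<lambda>w. gen (w, j)) (sh_word f g))"

fun star_word :: "('n \<Rightarrow> 'v \<Rightarrow> 'v) \<Rightarrow> 'v list \<times> 'n \<Rightarrow> 'v list \<times> 'n \<Rightarrow> ('v, 'n, 'k::field) tensN" where
  "star_word F ([], i) (g, j) = 0"
| "star_word F (x # f, i) (g, j) =
    lin_ext (\<lambda>(w, k). gen (x # w, k)) (star_word F (f, i) (g, j)) +
    lin_ext (\<lambda>w. gen (F j x # w, i)) (sh_word f g)"

definition ash :: "('n \<Rightarrow> 'k::field) \<Rightarrow> ('v, 'n, 'k) tensN \<Rightarrow> ('v, 'n, 'k) tensN \<Rightarrow> ('v, 'n, 'k) tensN" where
  "ash a = bilin_ext (ash_word a)"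

definition star :: "('n \<Rightarrow> 'v \<Rightarrow> 'v) \<Rightarrow> ('v, 'n, 'k::field) tensN \<Rightarrow> ('v, 'n, 'k) tensN \<Rightarrow> ('v, 'n, 'k) tensN" where
  "star F = bilin_ext (star_word F)"

definition bullet ::
    "('n \<Rightarrow> 'k::field) \<Rightarrow> ('n \<Rightarrow> 'v \<Rightarrow> 'v) \<Rightarrow>
      ('v, 'n, 'k) tensN \<Rightarrow> ('v, 'n, 'k) tensN \<Rightarrow> ('v, 'n, 'k) tensN" where
  "bullet a F u v = star F u v + ash a u v"


section \<open>Coproduct, counit and the second associative product\<close>

text \<open>
  Elements of \<open>S \<otimes> S\<close> are represented in the free vector space on pairs of monomials. It is an
  algebra for the componentwise product, and the coproduct is the algebra morphism making the
  generators primitive. For bilinear \<open>b\<close>, \<open>sweedler b H\<close> is the Sweedler sum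
  \<open>\<Sum> b H\<^sup>(\<^sup>1\<^sup>) H\<^sup>(\<^sup>2\<^sup>)\<close>.
\<close>

definition coprod ::
    "('v, 'n, 'k::field) sym \<Rightarrow>
      (('v list \<times> 'n) multiset \<times> ('v list \<times> 'n) multiset, 'k) poly_mapping" where
  "coprod = lin_ext (\<lambda>M. \<Prod>g\<in>#M. gen ({#g#}, {#}) + gen ({#}, {#g#}))"

definition sweedler ::
    "(('v, 'n, 'k::field) sym \<Rightarrow> ('v, 'n, 'k) sym \<Rightarrow> ('v, 'n, 'k) sym) \<Rightarrow>
      ('v, 'n, 'k) sym \<Rightarrow> ('v, 'n, 'k) sym" where
  "sweedler b H = lin_ext (\<lambda>(A, B). b (gen A) (gen B)) (coprod H)"

definition counit :: "('v, 'n, 'k::field) sym \<Rightarrow> 'k" where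
  "counit P = Poly_Mapping.lookup P {#}"

definition btl_list ::
    "('n \<Rightarrow> 'k::field) \<Rightarrow> ('v list \<times> 'n) list \<Rightarrow> ('v list \<times> 'n) list \<Rightarrow> ('v, 'n, 'k) sym" where
  "btl_list a xs ys =
    (\<Sum>I\<in>Pow {..<length ys}. \<Sum>\<theta>\<in>{\<theta> \<in> I \<rightarrow>\<^sub>E {..<length xs}. inj_on \<theta> I}.
      (\<Prod>i\<in>{..<length xs} - \<theta> ` I. gen {#xs ! i#}) *
      (\<Prod>j\<in>{..<length ys} - I. gen {#ys ! j#}) *
      (\<Prod>i\<in>I. incl (ash_word a (xs ! \<theta> i) (ys ! i))))"

text \<open>The formula depends only on the two monomials, so any enumeration of them may be used.\<close>

lemma btl_list_permute_left:
  fixes a :: "'n \<Rightarrow> 'k::field" and xs ys :: "('v list \<times> 'n) list"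
  assumes p: "p permutes {..<length xs}"
  shows "btl_list a (permute_list p xs) ys = btl_list a xs ys"
proof -
  let ?n = "length xs"
  have pin: "p i < ?n \<longleftrightarrow> i < ?n" for i
    using permutes_in_image[OF p, of i] by simp
  have q: "inv p permutes {..<?n}" by (rule permutes_inv[OF p])
  have qin: "inv p i < ?n \<longleftrightarrow> i < ?n" for i
    using permutes_in_image[OF q, of i] by simp
  have injp: "inj p" and pq: "p (inv p i) = i" and qp: "inv p (p i) = i" for i
    using permutes_inj[OF p] permutes_inverses[OF p] by auto
  show ?thesis
    unfolding btl_list_def length_permute_list
  proof (rule sum.cong[OF refl])
    fix I assume "I \<in> Pow {..<length ys}"
    have eq: "(\<Prod>i\<in>{..<?n} - \<theta> ` I. gen {#permute_list p xs ! i#}) =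
        (\<Prod>i\<in>{..<?n} - restrict (p \<circ> \<theta>) I ` I. gen {#xs ! i#} :: ('v, 'n, 'k) sym)"
      if "\<theta> \<in> I \<rightarrow>\<^sub>E {..<?n}" for \<theta>
      by (rule prod.reindex_bij_witness[where i = "inv p" and j = p])
        (use that p in \<open>auto simp: pq qp pin qin permute_list_nth image_iff Ball_def\<close>,
         (metis pq qp)+)
    show "(\<Sum>\<theta>\<in>{\<theta> \<in> I \<rightarrow>\<^sub>E {..<?n}. inj_on \<theta> I}.
          (\<Prod>i\<in>{..<?n} - \<theta> ` I. gen {#permute_list p xs ! i#}) *
          (\<Prod>j\<in>{..<length ys} - I. gen {#ys ! j#}) *
          (\<Prod>i\<in>I. incl (ash_word a (permute_list p xs ! \<theta> i) (ys ! i)))) =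
        (\<Sum>\<theta>\<in>{\<theta> \<in> I \<rightarrow>\<^sub>E {..<?n}. inj_on \<theta> I}.
          (\<Prod>i\<in>{..<?n} - \<theta> ` I. gen {#xs ! i#}) *
          (\<Prod>j\<in>{..<length ys} - I. gen {#ys ! j#}) *
          (\<Prod>i\<in>I. incl (ash_word a (xs ! \<theta> i) (ys ! i))))"
    proof (rule sum.reindex_bij_witness[where i = "\<lambda>\<theta>. restrict (inv p \<circ> \<theta>) I"
          and j = "\<lambda>\<theta>. restrict (p \<circ> \<theta>) I"], goal_cases)
      case (1 \<theta>)
      then show ?case by (auto simp: qp PiE_def extensional_def fun_eq_iff restrict_def)
    next
      case (2 \<theta>)
      then show ?case
        using injp by (auto simp: pin inj_on_def inj_def PiE_iff)
    next
      case (3 \<theta>)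
      then show ?case by (auto simp: pq PiE_def extensional_def fun_eq_iff restrict_def)
    next
      case (4 \<theta>)
      then show ?case
        using permutes_inj[OF q] by (auto simp: qin inj_on_def inj_def PiE_iff)
    next
      case (5 \<theta>)
      then have t: "\<theta> \<in> I \<rightarrow>\<^sub>E {..<?n}" by simp
      have "(\<Prod>i\<in>I. incl (ash_word a (xs ! restrict (p \<circ> \<theta>) I i) (ys ! i))) =
          (\<Prod>i\<in>I. incl (ash_word a (permute_list p xs ! \<theta> i) (ys ! i)))"
        by (rule prod.cong) (use t p in \<open>auto simp: permute_list_nth PiE_iff\<close>)
      then show ?case using eq[OF t] by simp
    qed
  qed
qed

lemma btl_list_permute_right:
  fixes a :: "'n \<Rightarrow> 'k::field" and xs ys :: "('v list \<times> 'n) list"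
  assumes p: "p permutes {..<length ys}"
  shows "btl_list a xs (permute_list p ys) = btl_list a xs ys"
proof -
  let ?n = "length ys"
  let ?T = "\<lambda>I. {\<theta> \<in> I \<rightarrow>\<^sub>E {..<length xs}. inj_on \<theta> I}"
  have pin: "p i < ?n \<longleftrightarrow> i < ?n" for i
    using permutes_in_image[OF p, of i] by simp
  have q: "inv p permutes {..<?n}" by (rule permutes_inv[OF p])
  have qin: "inv p i < ?n \<longleftrightarrow> i < ?n" for i
    using permutes_in_image[OF q, of i] by simp
  have injp: "inj p" and pq: "p (inv p i) = i" and qp: "inv p (p i) = i" for i
    using permutes_inj[OF p] permutes_inverses[OF p] by auto
  have injq: "inj (inv p)" using permutes_inj[OF q] .
  show ?thesis
    unfolding btl_list_def length_permute_list
  proof (rule sum.reindex_bij_witness[where i = "\<lambda>I. inv p ` I" and j = "\<lambda>I. p ` I"], goal_cases)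
    case (5 I)
    then have I: "I \<subseteq> {..<?n}" by simp
    show ?case
    proof (rule sum.reindex_bij_witness[where
            j = "\<lambda>\<theta>. restrict (\<theta> \<circ> p) I" and i = "\<lambda>\<theta>. restrict (\<theta> \<circ> inv p) (p ` I)"], goal_cases)
      case (1 \<theta>)
      then show ?case by (auto simp: pq qp PiE_def extensional_def fun_eq_iff restrict_def image_iff)
    next
      case (2 \<theta>)
      then show ?case using injp by (auto simp: inj_on_def inj_def PiE_iff)
    next
      case (3 \<theta>)
      then show ?case by (auto simp: pq qp PiE_def extensional_def fun_eq_iff restrict_def image_iff)
    next
      case (4 \<theta>)
      then show ?case by (auto simp: qp inj_on_def PiE_iff)
    next
      case (5 \<theta>)
      have im: "restrict (\<theta> \<circ> p) I ` I = \<theta> ` (p ` I)" by (auto simp: image_iff)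
      have c: "(\<Prod>j\<in>{..<?n} - I. gen {#permute_list p ys ! j#}) =
          (\<Prod>j\<in>{..<?n} - p ` I. gen {#ys ! j#} :: ('v, 'n, 'k) sym)"
        by (rule prod.reindex_bij_witness[where i = "inv p" and j = p])
          (use p injp in \<open>auto simp: pq qp pin qin permute_list_nth inj_image_mem_iff\<close>,
           metis pq image_eqI)
      have d: "(\<Prod>i\<in>I. incl (ash_word a (xs ! restrict (\<theta> \<circ> p) I i) (permute_list p ys ! i))) =
          (\<Prod>i\<in>p ` I. incl (ash_word a (xs ! \<theta> i) (ys ! i)))"
        by (subst prod.reindex) (use injp I p in
            \<open>auto simp: inj_on_def inj_def permute_list_nth intro!: prod.cong\<close>)
      show ?case unfolding im c d ..
    qed
  qed (auto simp: image_image pq qp pin qin)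
qed

lemma btl_list_mset_cong:
  assumes "mset xs = mset xs'" "mset ys = mset ys'"
  shows "btl_list a xs ys = btl_list a xs' ys'"
proof -
  obtain p where "p permutes {..<length xs'}" "permute_list p xs' = xs"
    using mset_eq_permutation[OF assms(1)] by blast
  moreover obtain q where "q permutes {..<length ys'}" "permute_list q ys' = ys"
    using mset_eq_permutation[OF assms(2)] by blast
  ultimately show ?thesis
    using btl_list_permute_left[of p xs' a "permute_list q ys'"]
      btl_list_permute_right[of q ys' a xs'] by simp
qed

definition btl :: "('n \<Rightarrow> 'k::field) \<Rightarrow> ('v, 'n, 'k) sym \<Rightarrow> ('v, 'n, 'k) sym \<Rightarrow> ('v, 'n, 'k) sym" where
  "btl a = bilin_ext (\<lambda>M N. btl_list a (SOME xs. mset xs = M) (SOME ys. mset ys = N))"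


section \<open>Extensions to the symmetric algebra\<close>

text \<open>
  A bilinear operation on \<open>S(T(V)\<^sup>N)\<close> is represented by an operation on representatives which is
  compatible with \<open>sym_eq\<close> and bilinear up to \<open>sym_eq\<close>.
\<close>

definition sym_bilinear ::
    "('k::field \<Rightarrow> 'v::ab_group_add \<Rightarrow> 'v) \<Rightarrow>
      (('v, 'n, 'k) sym \<Rightarrow> ('v, 'n, 'k) sym \<Rightarrow> ('v, 'n, 'k) sym) \<Rightarrow> bool" where
  "sym_bilinear scale b \<longleftrightarrow>
    (\<forall>P P' Q Q'. sym_eq scale P P' \<longrightarrow> sym_eq scale Q Q' \<longrightarrow> sym_eq scale (b P Q) (b P' Q')) \<and>
    (\<forall>P P' Q. sym_eq scale (b (P + P') Q) (b P Q + b P' Q)) \<and>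
    (\<forall>P Q Q'. sym_eq scale (b P (Q + Q')) (b P Q + b P Q')) \<and>
    (\<forall>c P Q. sym_eq scale (b (pscale c P) Q) (pscale c (b P Q))) \<and>
    (\<forall>c P Q. sym_eq scale (b P (pscale c Q)) (pscale c (b P Q)))"

definition is_star_extension ::
    "('k::field \<Rightarrow> 'v::ab_group_add \<Rightarrow> 'v) \<Rightarrow> ('n \<Rightarrow> 'k) \<Rightarrow> ('n \<Rightarrow> 'v \<Rightarrow> 'v) \<Rightarrow>
      (('v, 'n, 'k) sym \<Rightarrow> ('v, 'n, 'k) sym \<Rightarrow> ('v, 'n, 'k) sym) \<Rightarrow> bool" where
  "is_star_extension scale a F st \<longleftrightarrow>
    sym_bilinear scale st \<and>
    (\<forall>u v. sym_eq scale (st (incl u) (incl v)) (incl (star F u v))) \<and>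
    (\<forall>P. sym_eq scale (st P 1) P) \<and>
    (\<forall>P. sym_eq scale (st 1 P) (pscale (counit P) 1)) \<and>
    (\<forall>P Q y. sym_eq scale (st P (btl a Q (incl y)))
      (st (st P Q) (incl y) - st P (st Q (incl y)))) \<and>
    (\<forall>P Q R. sym_eq scale (st (btl a P Q) R)
      (sweedler (\<lambda>R1 R2. btl a (st P R1) (st Q R2)) R))"

definition is_bullet_extension ::
    "('k::field \<Rightarrow> 'v::ab_group_add \<Rightarrow> 'v) \<Rightarrow> ('n \<Rightarrow> 'k) \<Rightarrow> ('n \<Rightarrow> 'v \<Rightarrow> 'v) \<Rightarrow>
      (('v, 'n, 'k) sym \<Rightarrow> ('v, 'n, 'k) sym \<Rightarrow> ('v, 'n, 'k) sym) \<Rightarrow> bool" where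
  "is_bullet_extension scale a F bu \<longleftrightarrow>
    sym_bilinear scale bu \<and>
    (\<forall>u v. sym_eq scale (bu (incl u) (incl v)) (incl (bullet a F u v))) \<and>
    (\<forall>P. sym_eq scale (bu P 1) P) \<and>
    (\<forall>P. sym_eq scale (bu 1 P) (pscale (counit P) 1)) \<and>
    (\<forall>P Q y. sym_eq scale (bu P (Q * incl y))
      (bu (bu P Q) (incl y) - bu P (bu Q (incl y)))) \<and>
    (\<forall>P Q R. sym_eq scale (bu (P * Q) R)
      (sweedler (\<lambda>R1 R2. bu P R1 * bu Q R2) R))"

definition circledast ::
    "('n \<Rightarrow> 'k::field) \<Rightarrow> (('v, 'n, 'k) sym \<Rightarrow> ('v, 'n, 'k) sym \<Rightarrow> ('v, 'n, 'k) sym) \<Rightarrow>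
      ('v, 'n, 'k) sym \<Rightarrow> ('v, 'n, 'k) sym \<Rightarrow> ('v, 'n, 'k) sym" where
  "circledast a st P Q = sweedler (\<lambda>Q1 Q2. btl a (st P Q1) Q2) Q"

definition odot ::
    "(('v, 'n, 'k::field) sym \<Rightarrow> ('v, 'n, 'k) sym \<Rightarrow> ('v, 'n, 'k) sym) \<Rightarrow>
      ('v, 'n, 'k) sym \<Rightarrow> ('v, 'n, 'k) sym \<Rightarrow> ('v, 'n, 'k) sym" where
  "odot bu P Q = sweedler (\<lambda>Q1 Q2. bu P Q1 * Q2) Q"

end

theory Submission
  imports Defs
begin

text \<open>
  Write \<open>P \<lhd> Q\<close> for \<open>btl a P Q\<close> and let \<open>y \<in> T(V)\<^sup>N\<close>. Then \<open>P \<lhd> y = P y + D P\<close> with \<open>D\<close> the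
  derivation extending \<open>x \<mapsto> ash a x y\<close>. On words, \<open>x \<mapsto> x * y\<close> is a derivation of the associative
  product \<open>ash a\<close>; hence the derivation \<open>d\<close> of the commutative product extending it commutes with
  \<open>D\<close> up to a derivation of the same kind, and it is also the \<open>\<lhd>\<close>-derivation \<open>P \<mapsto> P * y\<close>. On the
  other side \<open>P \<bullet> y = d P + D P\<close>. So \<open>P \<circledast> y\<close> and \<open>P \<odot> y\<close> are the same element
  \<open>W P = P y + D P + d P\<close>. Both products are associative when the last factor is \<open>y\<close>, which says
  that \<open>Q \<mapsto> P \<circledast> Q\<close> and \<open>Q \<mapsto> P \<odot> Q\<close> commute with \<open>W\<close>. As \<open>Q y = W Q - D Q - d Q\<close>, where \<open>D\<close>
  and \<open>d\<close> preserve the degree, they agree by induction on the degree of \<open>Q\<close>.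
\<close>

section \<open>Linear maps between free vector spaces\<close>

lemma lookup_pscale [simp]: "Poly_Mapping.lookup (pscale c p) x = c * Poly_Mapping.lookup p x"
  by (simp add: pscale_def Poly_Mapping.map.rep_eq when_def)

interpretation poly_mapping: vector_space "pscale :: 'k::field \<Rightarrow> ('a, 'k) poly_mapping \<Rightarrow> ('a, 'k) poly_mapping"
  by unfold_locales (auto intro!: poly_mapping_eqI simp: lookup_add algebra_simps)

interpretation poly_mapping: vector_space_pair
  "pscale :: 'k::field \<Rightarrow> ('a, 'k) poly_mapping \<Rightarrow> ('a, 'k) poly_mapping"
  "pscale :: 'k::field \<Rightarrow> ('b, 'k) poly_mapping \<Rightarrow> ('b, 'k) poly_mapping"
  by unfold_locales

abbreviation plinear :: "(('a, 'k::field) poly_mapping \<Rightarrow> ('b, 'k) poly_mapping) \<Rightarrow> bool" where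
  "plinear \<equiv> Vector_Spaces.linear pscale pscale"

definition pbilinear ::
    "(('a, 'k::field) poly_mapping \<Rightarrow> ('b, 'k) poly_mapping \<Rightarrow> ('c, 'k) poly_mapping) \<Rightarrow> bool" where
  "pbilinear b \<longleftrightarrow> (\<forall>p. plinear (b p)) \<and> (\<forall>q. plinear (\<lambda>p. b p q))"

lemma plinearI:
  assumes "\<And>p q. f (p + q) = f p + f q" "\<And>c p. f (pscale c p) = pscale c (f p)"
  shows "plinear f"
  using assms by (simp add: Vector_Spaces.linear_iff poly_mapping.vector_space_axioms)

text \<open>Closure rules for linearity in one variable of a compound expression. With them an
  identity that is linear in each argument is reduced to words or monomials, one argument at a time,
  through \<open>plinear_eqI\<close>.\<close>

named_theorems plinear_intros

lemmas plinear_add = poly_mapping.linear_add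
lemmas plinear_scale = poly_mapping.linear_scale
lemmas plinear_0 = poly_mapping.linear_0
lemmas plinear_diff = poly_mapping.linear_diff
lemmas plinear_sum = poly_mapping.linear_sum

lemma plinear_compose: "plinear g \<Longrightarrow> plinear f \<Longrightarrow> plinear (\<lambda>p. g (f p))"
  by (rule plinearI) (simp_all only: plinear_add plinear_scale)

lemma plinear_id [plinear_intros]: "plinear (\<lambda>p. p)"
  by (rule plinearI) simp_all

lemma plinear_zero [plinear_intros]: "plinear (\<lambda>p. 0)"
  by (rule plinearI) simp_all

lemma plinear_plus [plinear_intros]: "plinear f \<Longrightarrow> plinear g \<Longrightarrow> plinear (\<lambda>p. f p + g p)"
  by (rule plinearI) (simp_all only: plinear_add plinear_scale poly_mapping.scale_right_distrib add_ac)

lemma plinear_minus [plinear_intros]: "plinear f \<Longrightarrow> plinear g \<Longrightarrow> plinear (\<lambda>p. f p - g p)"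
  by (rule plinearI)
    (simp_all only: plinear_add plinear_scale poly_mapping.scale_right_diff_distrib add_diff_add)

lemma plinear_pscale [plinear_intros]: "plinear f \<Longrightarrow> plinear (\<lambda>p. pscale c (f p))"
  by (rule plinearI)
    (simp_all add: plinear_add plinear_scale poly_mapping.scale_right_distrib mult.commute)

lemma plinear_sum_mset [plinear_intros]:
  assumes "\<And>x. x \<in># M \<Longrightarrow> plinear (f x)"
  shows "plinear (\<lambda>p. \<Sum>x\<in>#M. f x p)"
  using assms
proof (induction M)
  case (add x M)
  then have "plinear (\<lambda>p. f x p + (\<Sum>x\<in>#M. f x p))" by (intro plinear_plus) auto
  then show ?case by simp
qed (simp add: plinear_zero)

lemma plinear_sum_mset_apply: "plinear f \<Longrightarrow> f (\<Sum>x\<in>#M. g x) = (\<Sum>x\<in>#M. f (g x))"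
  by (induction M) (auto simp: plinear_0 plinear_add)

lemma lin_ext_superset:
  assumes "finite A" "Poly_Mapping.keys p \<subseteq> A"
  shows "lin_ext f p = (\<Sum>x\<in>A. pscale (Poly_Mapping.lookup p x) (f x))"
  unfolding lin_ext_def
  by (rule sum.mono_neutral_left) (use assms in \<open>simp_all add: in_keys_iff\<close>)

lemma plinear_lin_ext:
  fixes f :: "'a \<Rightarrow> ('b, 'k::field) poly_mapping"
  shows "plinear (lin_ext f)"
proof (rule plinearI)
  fix p q :: "('a, 'k) poly_mapping" and c
  let ?A = "Poly_Mapping.keys p \<union> Poly_Mapping.keys q"
  have "Poly_Mapping.keys (p + q) \<subseteq> ?A" by (rule keys_add)
  then show "lin_ext f (p + q) = lin_ext f p + lin_ext f q"
    by (simp add: lin_ext_superset[of ?A] lookup_add poly_mapping.scale_left_distrib sum.distrib)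
  have "Poly_Mapping.keys (pscale c p) \<subseteq> Poly_Mapping.keys p" by (auto simp: in_keys_iff)
  then show "lin_ext f (pscale c p) = pscale c (lin_ext f p)"
    by (simp add: lin_ext_superset[of "Poly_Mapping.keys p"] poly_mapping.scale_sum_right)
qed

lemma plinear_lin_ext_arg [plinear_intros]: "plinear g \<Longrightarrow> plinear (\<lambda>p. lin_ext f (g p))"
  by (rule plinear_compose[OF plinear_lin_ext])

lemma plinear_lin_ext_fun [plinear_intros]:
  assumes "\<And>x. plinear (\<lambda>p. f p x)"
  shows "plinear (\<lambda>p. lin_ext (f p) q)"
  by (rule plinearI)
    (auto simp: lin_ext_def plinear_add[OF assms] plinear_scale[OF assms] sum.distrib
      poly_mapping.scale_right_distrib poly_mapping.scale_sum_right mult.commute)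

lemma lin_ext_gen [simp]: "lin_ext f (gen x) = f x"
  by (simp add: lin_ext_def)

lemma poly_mapping_eq_lin_ext_gen: "lin_ext gen p = p"
proof (rule poly_mapping_eqI)
  fix k
  have "Poly_Mapping.lookup (lin_ext gen p) k =
      (\<Sum>x\<in>Poly_Mapping.keys p. if x = k then Poly_Mapping.lookup p x else 0)"
    unfolding lin_ext_def lookup_sum by (rule sum.cong) (simp_all add: lookup_single)
  also have "\<dots> = Poly_Mapping.lookup p k"
    by (simp add: sum.delta' not_in_keys_iff_lookup_eq_zero)
  finally show "Poly_Mapping.lookup (lin_ext gen p) k = Poly_Mapping.lookup p k" .
qed

lemma plinear_eq_lin_ext:
  assumes "plinear f"
  shows "f p = lin_ext (\<lambda>x. f (gen x)) p"
proof -
  have "f p = f (lin_ext gen p)" by (simp add: poly_mapping_eq_lin_ext_gen)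
  also have "\<dots> = lin_ext (\<lambda>x. f (gen x)) p"
    by (simp add: lin_ext_def plinear_sum[OF assms] plinear_scale[OF assms])
  finally show ?thesis .
qed

lemma plinear_eqI:
  assumes "plinear f" "plinear g" "\<And>x. f (gen x) = g (gen x)"
  shows "f p = g p"
  by (subst plinear_eq_lin_ext[OF assms(1)], subst plinear_eq_lin_ext[OF assms(2)]) (simp only: assms(3))

lemma lin_ext_compose: "plinear f \<Longrightarrow> f (lin_ext g p) = lin_ext (\<lambda>x. f (g x)) p"
  by (rule plinear_eqI[where p = p, OF plinear_compose]) (simp_all add: plinear_lin_ext)

lemma pscale_conv_mult:
  fixes p :: "('a::comm_monoid_add, 'k::field) poly_mapping"
  shows "pscale c p = Poly_Mapping.single 0 c * p"
  by (simp add: pscale_def mult_map_scale_conv_mult)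

lemma plinear_mult_right [plinear_intros]:
  fixes q :: "('a::comm_monoid_add, 'k::field) poly_mapping"
  shows "plinear f \<Longrightarrow> plinear (\<lambda>p. f p * q)"
  by (rule plinearI) (simp_all add: plinear_add plinear_scale pscale_conv_mult algebra_simps)

lemma plinear_mult_left [plinear_intros]:
  fixes q :: "('a::comm_monoid_add, 'k::field) poly_mapping"
  shows "plinear f \<Longrightarrow> plinear (\<lambda>p. q * f p)"
  by (rule plinearI) (simp_all add: plinear_add plinear_scale pscale_conv_mult algebra_simps)

lemma pbilinear_left: "pbilinear b \<Longrightarrow> plinear f \<Longrightarrow> plinear (\<lambda>p. b (f p) q)"
  unfolding pbilinear_def by (rule plinear_compose[of "\<lambda>p. b p q"]) auto

lemma pbilinear_right: "pbilinear b \<Longrightarrow> plinear f \<Longrightarrow> plinear (\<lambda>p. b q (f p))"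
  unfolding pbilinear_def by (rule plinear_compose[of "b q"]) auto

lemma pbilinearI:
  assumes "\<And>p. plinear (b p)" "\<And>q. plinear (\<lambda>p. b p q)"
  shows "pbilinear b"
  using assms by (simp add: pbilinear_def)

lemma pbilinear_bilin_ext: "pbilinear (bilin_ext f)"
  unfolding bilin_ext_def by (intro pbilinearI plinear_intros)

lemma pbilinear_eqI:
  assumes "pbilinear f" "pbilinear g" "\<And>x y. f (gen x) (gen y) = g (gen x) (gen y)"
  shows "f p q = g p q"
proof (rule plinear_eqI[where p = p])
  show "f (gen x) q = g (gen x) q" for x
    by (rule plinear_eqI[where p = q]) (use assms in \<open>auto simp: pbilinear_def\<close>)
qed (use assms in \<open>auto simp: pbilinear_def\<close>)

lemma bilin_ext_gen [simp]: "bilin_ext f (gen x) (gen y) = f x y"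
  by (simp add: bilin_ext_def)

lemma gen_plus: "gen (x + y) = gen x * (gen y :: ('a::monoid_add, 'k::field) poly_mapping)"
  by (simp add: mult_single)

lemma gen_add_mset: "gen (add_mset x M) = gen {#x#} * (gen M :: (_, 'k::field) poly_mapping)"
  by (simp add: mult_single)

lemma gen_empty: "gen {#} = (1 :: (_, 'k::field) poly_mapping)"
  using single_one by simp

section \<open>Derivations of the polynomial algebra\<close>

text \<open>
  With \<open>L = id\<close> this is the derivation extending \<open>\<phi>\<close>; the map \<open>L\<close> makes room for the other
  factors in the recursion satisfied by \<open>btl\<close>.
\<close>

definition contract ::
    "('g \<Rightarrow> ('h, 'k::field) poly_mapping) \<Rightarrow> (('g multiset, 'k) poly_mapping \<Rightarrow> ('h, 'k) poly_mapping) \<Rightarrow>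
      ('g multiset, 'k) poly_mapping \<Rightarrow> ('h::comm_monoid_add, 'k) poly_mapping" where
  "contract \<phi> L = lin_ext (\<lambda>M. \<Sum>g\<in>#M. \<phi> g * L (gen (M - {#g#})))"

abbreviation der :: "('g \<Rightarrow> ('g multiset, 'k::field) poly_mapping) \<Rightarrow>
    ('g multiset, 'k) poly_mapping \<Rightarrow> ('g multiset, 'k) poly_mapping" where
  "der \<phi> \<equiv> contract \<phi> (\<lambda>p. p)"

lemma contract_gen: "contract \<phi> L (gen M) = (\<Sum>g\<in>#M. \<phi> g * L (gen (M - {#g#})))"
  by (simp add: contract_def)

lemma plinear_contract [plinear_intros]: "plinear f \<Longrightarrow> plinear (\<lambda>p. contract \<phi> L (f p))"
  unfolding contract_def by (intro plinear_intros)

lemma plinear_contract_fun [plinear_intros]: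
  assumes "\<And>q. plinear (\<lambda>p. L p q)"
  shows "plinear (\<lambda>p. contract \<phi> (L p) q)"
  unfolding contract_def by (intro plinear_intros assms)

lemma plinear_contract_gen [plinear_intros]:
  assumes "\<And>g. plinear (\<lambda>p. \<phi> p g)"
  shows "plinear (\<lambda>p. contract (\<phi> p) L q)"
  unfolding contract_def by (intro plinear_intros assms)

lemma contract_one [simp]: "contract \<phi> L 1 = 0"
  using contract_gen[of \<phi> L "{#}"] by (simp add: gen_empty)

text \<open>Either the new factor \<open>g\<close> is the contracted one, or it survives and is
  absorbed into \<open>L\<close>.\<close>

lemma contract_gen_mult:
  assumes L: "plinear L"
  shows "contract \<phi> L (gen {#g#} * q) = \<phi> g * L q + contract \<phi> (\<lambda>p. L (gen {#g#} * p)) q"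
proof (rule plinear_eqI[where p = q])
  fix M
  have *: "(\<Sum>h\<in>#M. \<phi> h * L (gen (add_mset g M - {#h#}))) =
      (\<Sum>h\<in>#M. \<phi> h * L (gen {#g#} * gen (M - {#h#})))"
    by (rule arg_cong[where f = sum_mset], rule image_mset_cong)
      (simp add: gen_add_mset[symmetric])
  show "contract \<phi> L (gen {#g#} * gen M) =
      \<phi> g * L (gen M) + contract \<phi> (\<lambda>p. L (gen {#g#} * p)) (gen M)"
    using * by (simp only: gen_add_mset[symmetric] contract_gen) simp
qed (intro plinear_intros L)+

lemma contract_gen_single [simp]: "plinear L \<Longrightarrow> contract \<phi> L (gen {#g#}) = \<phi> g * L 1"
  using contract_gen_mult[of L \<phi> g 1] by simp

text \<open>In each summand \<open>f\<close> acts on the remaining factors, while the correction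
  \<open>g\<close> falls on the contracted one. The hypothesis is a Leibniz rule with two different
  maps because it has to cover \<open>p \<mapsto> btl a p (incl y)\<close>, whose correction is a
  derivation.\<close>

lemma contract_leibniz:
  assumes "plinear f" "\<And>p q. f (p * q) = p * f q + g p * q"
  shows "f (contract \<phi> L p) = contract \<phi> (\<lambda>q. f (L q)) p + contract (\<lambda>h. g (\<phi> h)) L p"
proof (rule plinear_eqI[where p = p])
  show "f (contract \<phi> L (gen M)) =
      contract \<phi> (\<lambda>q. f (L q)) (gen M) + contract (\<lambda>h. g (\<phi> h)) L (gen M)" for M
    by (simp add: contract_gen plinear_sum_mset_apply[OF assms(1)] assms(2) sum_mset.distrib)
qed (intro plinear_intros plinear_compose[OF assms(1)])+

lemma contract_mult_left: "contract \<phi> (\<lambda>q. r * L q) p = r * contract \<phi> L p"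
proof -
  have "plinear ((*) r)" by (intro plinear_intros)
  \<comment> \<open>Left multiplication by \<open>r\<close> moves past the contracted factor, so its
    correction is zero.\<close>
  from contract_leibniz[OF this, of "\<lambda>_. 0" \<phi> L p]
  have "r * contract \<phi> L p = contract \<phi> (\<lambda>q. r * L q) p + contract (\<lambda>_. 0) L p"
    by (simp only: mult.left_commute[of r] mult_zero_left add_0_right)
  also have "contract (\<lambda>_. 0) L p = 0" by (simp add: contract_def lin_ext_def)
  finally show ?thesis by simp
qed

lemma der_gen_mult: "der \<phi> (gen {#g#} * p) = \<phi> g * p + gen {#g#} * der \<phi> p"
  by (simp only: contract_gen_mult[OF plinear_id] contract_mult_left)

lemma der_mult: "der \<phi> (p * q) = der \<phi> p * q + p * der \<phi> q"
proof (rule plinear_eqI[where p = p])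
  fix M show "der \<phi> (gen M * q) = der \<phi> (gen M) * q + gen M * der \<phi> q"
  proof (induction M)
    case empty then show ?case by (simp add: gen_empty)
  next
    case (add g M)
    then show ?case
      by (simp only: gen_add_mset[of g M] der_gen_mult mult.assoc) (simp add: algebra_simps)
  qed
qed (intro plinear_intros)+

section \<open>The shuffle product\<close>

definition prefix_letter :: "'v \<Rightarrow> ('v, 'k::field) tens \<Rightarrow> ('v, 'k) tens" where
  "prefix_letter x = lin_ext (\<lambda>w. gen (x # w))"

definition shuf :: "('v, 'k::field) tens \<Rightarrow> ('v, 'k) tens \<Rightarrow> ('v, 'k) tens" where
  "shuf = bilin_ext sh_word"

lemma plinear_prefix_letter [plinear_intros]: "plinear f \<Longrightarrow> plinear (\<lambda>p. prefix_letter x (f p))"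
  unfolding prefix_letter_def by (intro plinear_intros)

lemma pbilinear_shuf: "pbilinear shuf"
  unfolding shuf_def by (rule pbilinear_bilin_ext)

lemmas plinear_shuf [plinear_intros] = pbilinear_left[OF pbilinear_shuf] pbilinear_right[OF pbilinear_shuf]

lemmas prefix_letter_add = plinear_add[OF plinear_prefix_letter[OF plinear_id]]

lemmas shuf_add = plinear_add[OF plinear_shuf(1)[OF plinear_id]] plinear_add[OF plinear_shuf(2)[OF plinear_id]]
lemmas shuf_0 [simp] = plinear_0[OF plinear_shuf(1)[OF plinear_id]] plinear_0[OF plinear_shuf(2)[OF plinear_id]]

lemma prefix_letter_gen: "prefix_letter x (gen w) = gen (x # w)"
  by (simp add: prefix_letter_def)

lemma sh_word_Nil_right [simp]: "sh_word u [] = gen u"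
  by (cases u) simp_all

lemma shuf_gen: "shuf (gen u) (gen v) = sh_word u v"
  by (simp add: shuf_def)

lemma shuf_gen_Nil [simp]: "shuf (gen []) p = p" "shuf p (gen []) = p"
  by (rule plinear_eqI[where p = p]; (intro plinear_intros)?; simp add: shuf_gen)+

lemma shuf_prefix_letter:
  "shuf (prefix_letter x p) (prefix_letter y q) =
    prefix_letter x (shuf p (prefix_letter y q)) + prefix_letter y (shuf (prefix_letter x p) q)"
proof -
  let ?f = "\<lambda>p q. shuf (prefix_letter x p) (prefix_letter y q)"
  let ?g = "\<lambda>p q. prefix_letter x (shuf p (prefix_letter y q)) + prefix_letter y (shuf (prefix_letter x p) q)"
  have "?f p q = ?g p q"
    by (rule pbilinear_eqI[of ?f ?g]; (intro pbilinearI plinear_intros)?)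
      (simp add: prefix_letter_gen shuf_gen prefix_letter_def[symmetric])
  then show ?thesis .
qed

lemma sh_word_commute: "sh_word u v = sh_word v u"
  by (induction u v rule: sh_word.induct) (simp_all add: add.commute)

lemma shuf_commute: "shuf p q = shuf q p"
proof -
  have "pbilinear (\<lambda>p q. shuf q p)" by (intro pbilinearI plinear_intros)
  then show ?thesis
    by (rule pbilinear_eqI[OF pbilinear_shuf]) (simp add: shuf_gen sh_word_commute)
qed

lemma shuf_assoc_gen: "shuf (shuf (gen u) (gen v)) (gen w) = shuf (gen u) (shuf (gen v) (gen w))"
proof (induction "length u + length v + length w" arbitrary: u v w rule: less_induct)
  case less
  show ?case
  proof (cases "u = [] \<or> v = [] \<or> w = []")
    case True then show ?thesis by auto
  next
    case False
    then obtain x u' y v' z w' where [simp]: "u = x # u'" "v = y # v'" "w = z # w'"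
      by (auto simp: neq_Nil_conv)
    \<comment> \<open>Both sides split according to which of \<open>x\<close>, \<open>y\<close>,
      \<open>z\<close> comes first, and one instance of the induction hypothesis settles each case.
      The terms beginning with \<open>z\<close> appear on the left as two summands, so that instance
      is used with \<open>z\<close> already prefixed.\<close>
    show ?thesis
      using less(1)[of u' v w] less(1)[of u v' w] arg_cong[where f = "prefix_letter z", OF less(1)[of u v w']]
      by (simp add: prefix_letter_gen[symmetric] shuf_prefix_letter shuf_add prefix_letter_add algebra_simps)
  qed
qed

lemma shuf_assoc: "shuf (shuf p q) r = shuf p (shuf q r)"
proof (rule plinear_eqI[where p = p])
  fix u show "shuf (shuf (gen u) q) r = shuf (gen u) (shuf q r)"
  proof (rule plinear_eqI[where p = q])
    fix v show "shuf (shuf (gen u) (gen v)) r = shuf (gen u) (shuf (gen v) r)"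
      by (rule plinear_eqI[where p = r]; (intro plinear_intros)?) (rule shuf_assoc_gen)
  qed (intro plinear_intros)+
qed (intro plinear_intros)+

text \<open>The right factor of a product \<open>_ * (h \<epsilon>\<^sub>j)\<close> acts on each word by such an operator, with \<open>\<phi> = F\<^sub>j\<close>.\<close>

fun sh_der :: "('v \<Rightarrow> 'v) \<Rightarrow> 'v list \<Rightarrow> 'v list \<Rightarrow> ('v, 'k::field) tens" where
  "sh_der \<phi> h [] = 0"
| "sh_der \<phi> h (x # f) = prefix_letter x (sh_der \<phi> h f) + prefix_letter (\<phi> x) (sh_word f h)"

lemma sh_der_prefix_letter:
  "lin_ext (sh_der \<phi> h) (prefix_letter x p) =
    prefix_letter x (lin_ext (sh_der \<phi> h) p) + prefix_letter (\<phi> x) (shuf p (gen h))"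
  by (rule plinear_eqI[where p = p]; (intro plinear_intros)?)
    (simp add: prefix_letter_gen shuf_gen)

text \<open>The operator replaces one letter by its image and shuffles \<open>h\<close> into the
  letters behind it. If \<open>x\<close> is hit, these are the letters of \<open>u\<close> and of
  \<open>y # v\<close>, and by associativity and commutativity \<open>h\<close> may be shuffled into
  \<open>u\<close> alone.\<close>

lemma sh_der_shuf_gen:
  "lin_ext (sh_der \<phi> h) (shuf (gen u) (gen v)) =
    shuf (lin_ext (sh_der \<phi> h) (gen u)) (gen v) + shuf (gen u) (lin_ext (sh_der \<phi> h) (gen v))"
proof (induction u v rule: sh_word.induct)
  case (3 x u y v)
  show ?case using 3
    by (simp only: prefix_letter_gen[symmetric] shuf_prefix_letter sh_der_prefix_letter
        plinear_add[OF plinear_lin_ext] shuf_add prefix_letter_add)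
       (simp add: shuf_assoc shuf_commute[of "gen h" "prefix_letter y (gen v)"])
qed simp_all

lemma sh_der_shuf:
  "lin_ext (sh_der \<phi> h) (shuf p q) = shuf (lin_ext (sh_der \<phi> h) p) q + shuf p (lin_ext (sh_der \<phi> h) q)"
proof (rule plinear_eqI[where p = p])
  fix u show "lin_ext (sh_der \<phi> h) (shuf (gen u) q) =
      shuf (lin_ext (sh_der \<phi> h) (gen u)) q + shuf (gen u) (lin_ext (sh_der \<phi> h) q)"
    by (rule plinear_eqI[where p = q]; (intro plinear_intros)?) (rule sh_der_shuf_gen)
qed (intro plinear_intros)+

section \<open>The products on \<open>T(V)\<^sup>N\<close>\<close>

definition tag :: "'n \<Rightarrow> ('v, 'k::field) tens \<Rightarrow> ('v, 'n, 'k) tensN" where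
  "tag i = lin_ext (\<lambda>w. gen (w, i))"

lemma plinear_tag [plinear_intros]: "plinear f \<Longrightarrow> plinear (\<lambda>p. tag i (f p))"
  unfolding tag_def by (intro plinear_intros)

lemma tag_gen: "tag i (gen w) = gen (w, i)"
  by (simp add: tag_def)

lemmas tag_linear = plinear_0[OF plinear_tag[OF plinear_id]] plinear_add[OF plinear_tag[OF plinear_id]]
  plinear_scale[OF plinear_tag[OF plinear_id]]

lemma pbilinear_ash: "pbilinear (ash a)"
  unfolding ash_def by (rule pbilinear_bilin_ext)

lemma pbilinear_star: "pbilinear (star F)"
  unfolding star_def by (rule pbilinear_bilin_ext)

lemmas plinear_ash [plinear_intros] = pbilinear_left[OF pbilinear_ash] pbilinear_right[OF pbilinear_ash]
lemmas plinear_star [plinear_intros] = pbilinear_left[OF pbilinear_star] pbilinear_right[OF pbilinear_star]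

lemma ash_gen: "ash a (gen x) (gen y) = ash_word a x y"
  by (simp add: ash_def)

lemma star_gen: "star F (gen x) (gen y) = star_word F x y"
  by (simp add: star_def)

lemma ash_tag: "ash a (tag i p) (tag j q) = pscale (a i) (tag j (shuf p q))"
proof -
  let ?f = "\<lambda>p q. ash a (tag i p) (tag j q)" and ?g = "\<lambda>p q. pscale (a i) (tag j (shuf p q))"
  have "?f p q = ?g p q"
    by (rule pbilinear_eqI[of ?f ?g]; (intro pbilinearI plinear_intros)?)
      (simp add: tag_gen ash_gen shuf_gen tag_def[symmetric])
  then show ?thesis .
qed

text \<open>The left index \<open>i\<close> is never changed by the recursion, and of the right
  index only the map \<open>F j\<close> matters.\<close>

lemma star_word_conv_sh_der:
  fixes f g :: "'v list" and i j :: 'n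
  shows "star_word F (f, i) (g, j) = (tag i (sh_der (F j) g f) :: ('v, 'n, 'k::field) tensN)"
proof (induction f)
  case (Cons x f)
  have "lin_ext (\<lambda>(w, k). gen (x # w, k)) (tag i p) = tag i (prefix_letter x p)" for p :: "('v, 'k) tens"
    by (rule plinear_eqI[where p = p]; (intro plinear_intros)?) (simp add: tag_gen prefix_letter_gen)
  moreover have "lin_ext (\<lambda>w. gen (y # w, i)) p = tag i (prefix_letter y p)" for y and p :: "('v, 'k) tens"
    by (rule plinear_eqI[where p = p]; (intro plinear_intros)?) (simp add: tag_gen prefix_letter_gen)
  ultimately show ?case by (simp add: Cons tag_linear)
qed (simp add: tag_linear)

lemma star_tag: "star F (tag i p) (gen (h, j)) = tag i (lin_ext (sh_der (F j) h) p)"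
  by (rule plinear_eqI[where p = p]; (intro plinear_intros)?)
    (simp add: tag_gen star_gen star_word_conv_sh_der)

lemma ash_assoc: "ash a (ash a u v) w = ash a u (ash a v w)"
proof (rule plinear_eqI[where p = u])
  fix x show "ash a (ash a (gen x) v) w = ash a (gen x) (ash a v w)"
  proof (rule plinear_eqI[where p = v])
    fix y show "ash a (ash a (gen x) (gen y)) w = ash a (gen x) (ash a (gen y) w)"
    proof (rule plinear_eqI[where p = w])
      fix z show "ash a (ash a (gen x) (gen y)) (gen z) = ash a (gen x) (ash a (gen y) (gen z))"
        by (cases x; cases y; cases z)
          (simp add: tag_gen[symmetric] ash_tag shuf_assoc mult.commute
            plinear_scale[OF plinear_ash(1)[OF plinear_id]] plinear_scale[OF plinear_ash(2)[OF plinear_id]])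
    qed (intro plinear_intros)+
  qed (intro plinear_intros)+
qed (intro plinear_intros)+

text \<open>Up to a scalar and the choice of an index, \<open>ash\<close> is the shuffle product,
  and \<open>star\<close> by a fixed element leaves the left index alone. The rule is therefore the
  derivation property \<open>sh_der_shuf\<close>.\<close>

lemma star_ash:
  fixes u v w :: "('v, 'n, 'k::field) tensN"
  shows "star F (ash a u v) w = ash a (star F u w) v + ash a u (star F v w)"
proof (rule plinear_eqI[where p = u])
  fix x show "star F (ash a (gen x) v) w = ash a (star F (gen x) w) v + ash a (gen x) (star F v w)"
  proof (rule plinear_eqI[where p = v])
    fix y show "star F (ash a (gen x) (gen y)) w =
        ash a (star F (gen x) w) (gen y) + ash a (gen x) (star F (gen y) w)"
    proof (rule plinear_eqI[where p = w])
      fix z :: "'v list \<times> 'n"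
      obtain f i g j h k where "x = (f, i)" "y = (g, j)" "z = (h, k)"
        by (cases x; cases y; cases z)
      show "star F (ash a (gen x) (gen y)) (gen z) =
          ash a (star F (gen x) (gen z)) (gen y) + ash a (gen x) (star F (gen y) (gen z))"
        by (simp only: \<open>x = (f, i)\<close> \<open>y = (g, j)\<close> \<open>z = (h, k)\<close> tag_gen[symmetric, of f i] tag_gen[symmetric, of g j]
            star_tag ash_tag sh_der_shuf tag_linear poly_mapping.scale_right_distrib
            plinear_scale[OF plinear_star(1)[OF plinear_id]])
    qed (intro plinear_intros)+
  qed (intro plinear_intros)+
qed (intro plinear_intros)+

section \<open>A recursion for the second associative product\<close>

text \<open>An injection on \<open>insert n I\<close> is a value \<open>i\<close> at
  \<open>n\<close> together with an injection on \<open>I\<close> that avoids \<open>i\<close>.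
  Resetting the value at \<open>n\<close> to \<open>undefined\<close> makes the restriction
  extensional, as \<open>PiE\<close> demands.\<close>

lemma sum_injections_insert:
  fixes h :: "'a \<Rightarrow> ('b \<Rightarrow> 'a) \<Rightarrow> 'c::comm_monoid_add"
  assumes "n \<notin> I" "finite I" "finite X"
  shows "(\<Sum>\<theta>\<in>{\<theta> \<in> insert n I \<rightarrow>\<^sub>E X. inj_on \<theta> (insert n I)}. h (\<theta> n) (\<theta>(n := undefined))) =
    (\<Sum>i\<in>X. \<Sum>\<theta>\<in>{\<theta> \<in> I \<rightarrow>\<^sub>E X - {i}. inj_on \<theta> I}. h i \<theta>)"
proof -
  have fin: "finite {\<theta> \<in> I \<rightarrow>\<^sub>E X - {i}. inj_on \<theta> I}" for i
    using assms finite_PiE[of I "\<lambda>_. X - {i}"] by simp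
  have "(\<Sum>i\<in>X. \<Sum>\<theta>\<in>{\<theta> \<in> I \<rightarrow>\<^sub>E X - {i}. inj_on \<theta> I}. h i \<theta>) =
      (\<Sum>(i, \<theta>)\<in>Sigma X (\<lambda>i. {\<theta> \<in> I \<rightarrow>\<^sub>E X - {i}. inj_on \<theta> I}). h i \<theta>)"
    using assms fin by (subst sum.Sigma) auto
  also have "\<dots> = (\<Sum>\<theta>\<in>{\<theta> \<in> insert n I \<rightarrow>\<^sub>E X. inj_on \<theta> (insert n I)}. h (\<theta> n) (\<theta>(n := undefined)))"
  proof (rule sum.reindex_bij_witness[where i = "\<lambda>\<theta>. (\<theta> n, \<theta>(n := undefined))"
        and j = "\<lambda>(i, \<theta>). \<theta>(n := i)"], goal_cases)
    case (1 p)
    then show ?case using assms(1)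
      by (auto simp: fun_eq_iff PiE_def extensional_def)
  next
    case (2 p)
    then obtain i \<theta> where p: "p = (i, \<theta>)" "i \<in> X" "\<theta> \<in> I \<rightarrow>\<^sub>E X - {i}" "inj_on \<theta> I" by auto
    then have i: "i \<notin> \<theta> ` I" and "\<theta> \<in> I \<rightarrow>\<^sub>E X" by auto
    then have "\<theta>(n := i) \<in> insert n I \<rightarrow>\<^sub>E X" using p(2) by (intro PiE_fun_upd)
    moreover have "inj_on (\<theta>(n := i)) I" using p(4) i by (rule inj_on_fun_updI)
    moreover have "(\<theta>(n := i)) ` I = \<theta> ` I" using assms(1) by auto
    ultimately show ?case using assms(1) i by (simp add: p(1))
  next
    case (4 \<theta>)
    then show ?case using assms(1)
      by (auto simp: PiE_def extensional_def inj_on_def Pi_def)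
  next
    case (5 p)
    then show ?case using assms(1)
      by (auto simp: PiE_def extensional_def fun_eq_iff intro!: arg_cong2[where f = h])
  qed auto
  finally show ?thesis by simp
qed

text \<open>Partial matchings are sorted by the partner of \<open>n\<close>: if there is none, the
  factor \<open>y n\<close> remains; if it is \<open>i\<close>, the pair contributes
  \<open>m i n\<close> and \<open>i\<close> is no longer available.\<close>

lemma sum_partial_matchings_insert:
  fixes x :: "'a \<Rightarrow> 'c::comm_ring_1" and y :: "'b \<Rightarrow> 'c" and m :: "'a \<Rightarrow> 'b \<Rightarrow> 'c"
  defines "B X Y \<equiv> \<Sum>I\<in>Pow Y. \<Sum>\<theta>\<in>{\<theta> \<in> I \<rightarrow>\<^sub>E X. inj_on \<theta> I}.
      (\<Prod>i\<in>X - \<theta> ` I. x i) * (\<Prod>j\<in>Y - I. y j) * (\<Prod>j\<in>I. m (\<theta> j) j)"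
  assumes "finite X" "finite Y" "n \<notin> Y"
  shows "B X (insert n Y) = y n * B X Y + (\<Sum>i\<in>X. m i n * B (X - {i}) Y)"
proof -
  let ?T = "\<lambda>I X. {\<theta> \<in> I \<rightarrow>\<^sub>E X. inj_on \<theta> I}"
  let ?t = "\<lambda>X Y I \<theta>. (\<Prod>i\<in>X - \<theta> ` I. x i) * (\<Prod>j\<in>Y - I. y j) * (\<Prod>j\<in>I. m (\<theta> j) j)"
  have B: "B X Y = (\<Sum>I\<in>Pow Y. \<Sum>\<theta>\<in>?T I X. ?t X Y I \<theta>)" for X Y
    by (simp add: B_def)
  have inj: "inj_on (insert n) (Pow Y)"
    using assms(4) by (intro inj_onI) (metis Diff_insert_absorb PowD subsetD)
  have disj: "Pow Y \<inter> insert n ` Pow Y = {}"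
    using assms(4) by auto
  have split: "B X (insert n Y) = (\<Sum>I\<in>Pow Y. \<Sum>\<theta>\<in>?T I X. ?t X (insert n Y) I \<theta>) +
      (\<Sum>I\<in>Pow Y. \<Sum>\<theta>\<in>?T (insert n I) X. ?t X (insert n Y) (insert n I) \<theta>)"
    unfolding B Pow_insert
    by (subst sum.union_disjoint)
      (simp_all only: disj sum.reindex[OF inj] comp_def finite_Pow_iff finite_imageI assms(3))
  have old: "(\<Sum>I\<in>Pow Y. \<Sum>\<theta>\<in>?T I X. ?t X (insert n Y) I \<theta>) = y n * B X Y"
    unfolding B sum_distrib_left
  proof (intro sum.cong refl)
    fix I \<theta> assume "I \<in> Pow Y"
    then have "insert n Y - I = insert n (Y - I)" "finite (Y - I)" "n \<notin> Y - I"
      using assms(3,4) by auto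
    then show "?t X (insert n Y) I \<theta> = y n * ?t X Y I \<theta>"
      by (simp add: mult_ac)
  qed
  have new: "(\<Sum>I\<in>Pow Y. \<Sum>\<theta>\<in>?T (insert n I) X. ?t X (insert n Y) (insert n I) \<theta>) =
      (\<Sum>I\<in>Pow Y. \<Sum>i\<in>X. \<Sum>\<theta>\<in>?T I (X - {i}). m i n * ?t (X - {i}) Y I \<theta>)"
  proof (rule sum.cong[OF refl])
    fix I assume "I \<in> Pow Y"
    then have I: "n \<notin> I" "finite I" "insert n Y - insert n I = Y - I"
      using assms(3,4) by (auto intro: finite_subset)
    have "(\<Sum>\<theta>\<in>?T (insert n I) X. ?t X (insert n Y) (insert n I) \<theta>) =
        (\<Sum>\<theta>\<in>?T (insert n I) X. m (\<theta> n) n * ?t (X - {\<theta> n}) Y I (\<theta>(n := undefined)))"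
    proof (rule sum.cong[OF refl])
      fix \<theta> :: "'b \<Rightarrow> 'a"
      have im: "(\<theta>(n := undefined)) ` I = \<theta> ` I" using I by auto
      have "X - {\<theta> n} - \<theta> ` I = X - \<theta> ` insert n I" by auto
      moreover have "(\<Prod>j\<in>I. m ((\<theta>(n := undefined)) j) j) = (\<Prod>j\<in>I. m (\<theta> j) j)"
        using I by (intro prod.cong) auto
      ultimately show "?t X (insert n Y) (insert n I) \<theta> =
          m (\<theta> n) n * ?t (X - {\<theta> n}) Y I (\<theta>(n := undefined))"
        by (simp only: im I(3) prod.insert[OF I(2,1)] mult_ac)
    qed
    also have "\<dots> = (\<Sum>i\<in>X. \<Sum>\<theta>\<in>?T I (X - {i}). m i n * ?t (X - {i}) Y I \<theta>)"
      by (rule sum_injections_insert[where h = "\<lambda>i \<theta>. m i n * ?t (X - {i}) Y I \<theta>", OF I(1,2) assms(2)])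
    finally show "(\<Sum>\<theta>\<in>?T (insert n I) X. ?t X (insert n Y) (insert n I) \<theta>) = \<dots>" .
  qed
  have swap: "(\<Sum>I\<in>Pow Y. \<Sum>i\<in>X. \<Sum>\<theta>\<in>?T I (X - {i}). m i n * ?t (X - {i}) Y I \<theta>) =
      (\<Sum>i\<in>X. m i n * B (X - {i}) Y)"
    by (subst sum.swap) (simp only: B sum_distrib_left)
  show ?thesis
    by (simp only: split old new swap)
qed

text \<open>The factors of the right monomial are treated one after the other: each stays alone or
  is paired with one factor of \<open>M\<close>. Summation over the multiset counts equal factors of
  \<open>M\<close> separately, as the sum over injections of positions does.\<close>

primrec btl_rec :: "('n \<Rightarrow> 'k::field) \<Rightarrow> ('v list \<times> 'n) list \<Rightarrow> ('v list \<times> 'n) multiset \<Rightarrow> ('v, 'n, 'k) sym" where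
  "btl_rec a [] M = gen M"
| "btl_rec a (y # ys) M = gen {#y#} * btl_rec a ys M +
    (\<Sum>x\<in>#M. incl (ash_word a x y) * btl_rec a ys (M - {#x#}))"

lemma btl_list_eq_btl_rec:
  fixes a :: "'n \<Rightarrow> 'k::field" and xs ys :: "('v list \<times> 'n) list"
  shows "btl_list a xs ys = btl_rec a ys (mset xs)"
proof -
  \<comment> \<open>Removing a matched position destroys the initial segment, so the sum is
    generalised to arbitrary sets of positions. The left monomial is then the multiset of entries at
    the positions in \<open>X\<close>.\<close>
  define B :: "nat set \<Rightarrow> nat set \<Rightarrow> ('v, 'n, 'k) sym" where
    "B X Y = (\<Sum>I\<in>Pow Y. \<Sum>\<theta>\<in>{\<theta> \<in> I \<rightarrow>\<^sub>E X. inj_on \<theta> I}.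
      (\<Prod>i\<in>X - \<theta> ` I. gen {#xs ! i#}) * (\<Prod>j\<in>Y - I. gen {#ys ! j#}) *
      (\<Prod>j\<in>I. incl (ash_word a (xs ! \<theta> j) (ys ! j))))" for X Y
  have "B X (set l) = btl_rec a (map ((!) ys) l) (image_mset ((!) xs) (mset_set X))"
    if "distinct l" "finite X" for l X
    using that
  proof (induction l arbitrary: X)
    case Nil
    have "(\<Prod>i\<in>X. gen {#xs ! i#}) = (gen (image_mset ((!) xs) (mset_set X)) :: ('v, 'n, 'k) sym)"
      using \<open>finite X\<close> by induction (simp_all add: gen_empty gen_add_mset[symmetric])
    then show ?case by (simp add: B_def)
  next
    case (Cons n l)
    have "image_mset ((!) xs) (mset_set X) - {#xs ! i#} = image_mset ((!) xs) (mset_set (X - {i}))"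
      if "i \<in> X" for i
      using \<open>finite X\<close> that by (simp add: mset_set.remove[of X i])
    then have "image_mset (\<lambda>i. incl (ash_word a (xs ! i) (ys ! n)) *
          btl_rec a (map ((!) ys) l) (image_mset ((!) xs) (mset_set X) - {#xs ! i#})) (mset_set X) =
        image_mset (\<lambda>i. incl (ash_word a (xs ! i) (ys ! n)) * B (X - {i}) (set l)) (mset_set X)"
      using Cons.prems by (intro image_mset_cong) (simp add: Cons.IH)
    then have "(\<Sum>x\<in>#image_mset ((!) xs) (mset_set X). incl (ash_word a x (ys ! n)) *
          btl_rec a (map ((!) ys) l) (image_mset ((!) xs) (mset_set X) - {#x#})) =
        (\<Sum>i\<in>X. incl (ash_word a (xs ! i) (ys ! n)) * B (X - {i}) (set l))"
      by (simp add: multiset.map_comp comp_def sum_unfold_sum_mset)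
    moreover have "B X (insert n (set l)) = gen {#ys ! n#} * B X (set l) +
        (\<Sum>i\<in>X. incl (ash_word a (xs ! i) (ys ! n)) * B (X - {i}) (set l))"
      unfolding B_def using Cons.prems by (intro sum_partial_matchings_insert) auto
    ultimately show ?case using Cons by simp
  qed
  note * = this[of "[0..<length ys]" "{..<length xs}"]
  have "btl_list a xs ys = B {..<length xs} (set [0..<length ys])"
    by (simp only: btl_list_def B_def set_upt atLeast0LessThan)
  also have "\<dots> = btl_rec a ys (image_mset ((!) xs) (mset_set {..<length xs}))"
    using * by (simp only: distinct_upt finite_lessThan map_nth)
  also have "image_mset ((!) xs) (mset_set {..<length xs}) = mset (map ((!) xs) [0..<length xs])"
    by (simp only: mset_map mset_upt atLeast0LessThan)
  finally show ?thesis by (simp only: map_nth)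
qed

section \<open>The product \<open>btl\<close> on linear combinations\<close>

lemma pbilinear_btl: "pbilinear (btl a)"
  unfolding btl_def by (rule pbilinear_bilin_ext)

lemmas plinear_btl [plinear_intros] = pbilinear_left[OF pbilinear_btl] pbilinear_right[OF pbilinear_btl]

text \<open>By \<open>btl_list_mset_cong\<close> the enumerations picked by \<open>SOME\<close> may
  be replaced by any others.\<close>

lemma btl_gen: "btl a (gen M) (gen (mset ys)) = btl_rec a ys M"
proof -
  obtain xs where M: "M = mset xs" using ex_mset[of M] by blast
  have "mset (SOME xs'. mset xs' = mset xs) = mset xs" "mset (SOME ys'. mset ys' = mset ys) = mset ys"
    by (rule someI_ex, blast)+
  from btl_list_mset_cong[OF this] show ?thesis
    unfolding M btl_list_eq_btl_rec[symmetric] by (simp only: btl_def bilin_ext_gen)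
qed

lemma btl_one_right [simp]: "btl a p 1 = p"
proof (rule plinear_eqI[where p = p])
  show "btl a (gen M) 1 = gen M" for M
    using btl_gen[of a M "[]"] by (simp add: gen_empty)
qed (intro plinear_intros)+

text \<open>The recursion in linear form: \<open>y\<close> stays alone, or \<open>contract\<close>
  pairs it with a factor of \<open>p\<close> and leaves the rest of \<open>p\<close> to be
  multiplied by \<open>q\<close>.\<close>

lemma btl_gen_mult:
  fixes p q :: "('v, 'n, 'k::field) sym"
  shows
  "btl a p (gen {#y#} * q) =
    gen {#y#} * btl a p q + contract (\<lambda>x. incl (ash_word a x y)) (\<lambda>r. btl a r q) p"
proof (rule plinear_eqI[where p = p])
  fix M show "btl a (gen M) (gen {#y#} * q) =
      gen {#y#} * btl a (gen M) q + contract (\<lambda>x. incl (ash_word a x y)) (\<lambda>r. btl a r q) (gen M)"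
  proof (rule plinear_eqI[where p = q])
    fix N :: "('v list \<times> 'n) multiset"
    obtain ys where ys: "N = mset ys" using ex_mset[of N] by blast
    have "gen {#y#} * gen N = (gen (mset (y # ys)) :: ('v, 'n, 'k) sym)"
      by (simp only: ys mset.simps gen_add_mset[of y "mset ys"])
    then show "btl a (gen M) (gen {#y#} * gen N) =
      gen {#y#} * btl a (gen M) (gen N) + contract (\<lambda>x. incl (ash_word a x y)) (\<lambda>r. btl a r (gen N)) (gen M)"
      by (simp only: ys btl_gen contract_gen btl_rec.simps)
  qed (intro plinear_intros)+
qed (intro plinear_intros)+

section \<open>The derivations attached to an element of T(V)^N\<close>

lemma plinear_incl [plinear_intros]: "plinear f \<Longrightarrow> plinear (\<lambda>p. incl (f p))"
  unfolding incl_def by (intro plinear_intros)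

lemmas incl_add = plinear_add[OF plinear_incl[OF plinear_id]]

lemma incl_gen: "incl (gen g) = gen {#g#}"
  by (simp add: incl_def)

lemma contract_incl_mult:
  assumes "plinear L"
  shows "contract \<phi> L (incl u * q) = lin_ext \<phi> u * L q + contract \<phi> (\<lambda>p. L (incl u * p)) q"
  by (rule plinear_eqI[where p = u]; (intro plinear_intros plinear_compose[OF assms])?)
    (simp only: incl_gen lin_ext_gen contract_gen_mult[OF assms])

lemma der_incl: "der \<phi> (incl u) = lin_ext \<phi> u"
  using contract_incl_mult[OF plinear_id, of \<phi> u 1] by simp

text \<open>For fixed \<open>y\<close>, \<open>der_ash a y\<close> is the derivation
  \<open>D\<close> of the introductory explanation and \<open>der_star F y\<close> the derivation
  \<open>d\<close>.\<close>

abbreviation der_ash :: "('n \<Rightarrow> 'k::field) \<Rightarrow> ('v, 'n, 'k) tensN \<Rightarrow> ('v, 'n, 'k) sym \<Rightarrow> ('v, 'n, 'k) sym" where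
  "der_ash a y \<equiv> der (\<lambda>x. incl (ash a (gen x) y))"

abbreviation der_star :: "('n \<Rightarrow> 'v \<Rightarrow> 'v) \<Rightarrow> ('v, 'n, 'k::field) tensN \<Rightarrow> ('v, 'n, 'k) sym \<Rightarrow> ('v, 'n, 'k) sym" where
  "der_star F y \<equiv> der (\<lambda>x. incl (star F (gen x) y))"

lemma der_ash_incl: "der_ash a y (incl u) = incl (ash a u y)"
  by (rule plinear_eqI[where p = u]; (intro plinear_intros)?) (simp add: der_incl)

lemma der_star_incl: "der_star F y (incl u) = incl (star F u y)"
  by (rule plinear_eqI[where p = u]; (intro plinear_intros)?) (simp add: der_incl)

text \<open>The commutator of two derivations is again a derivation, so comparing it with
  \<open>der \<chi>\<close> on generators is enough.\<close>

lemma der_commutator: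
  assumes "\<And>g. der \<phi> (\<psi> g) = der \<psi> (\<phi> g) + \<chi> g"
  shows "der \<phi> (der \<psi> p) = der \<psi> (der \<phi> p) + der \<chi> p"
proof (rule plinear_eqI[where p = p])
  fix M show "der \<phi> (der \<psi> (gen M)) = der \<psi> (der \<phi> (gen M)) + der \<chi> (gen M)"
  proof (induction M)
    case empty
    have "contract \<theta> (\<lambda>p. p) 0 = 0" for \<theta> :: "'a \<Rightarrow> ('a multiset, 'b) poly_mapping"
      by (rule plinear_0) (intro plinear_intros)
    then show ?case by (simp add: gen_empty)
  next
    case (add g M)
    have der_add: "der \<theta> (r + s) = der \<theta> r + der \<theta> s"
      for \<theta> :: "'a \<Rightarrow> ('a multiset, 'b) poly_mapping" and r s
      by (rule plinear_add) (intro plinear_intros)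
    have der_single: "der \<theta> (gen {#g#}) = \<theta> g" for \<theta> :: "'a \<Rightarrow> ('a multiset, 'b) poly_mapping"
      by (simp add: plinear_id)
    show ?case
      by (simp only: gen_add_mset[of g M] der_add der_mult der_single add.IH assms) (simp add: algebra_simps)
  qed
qed (intro plinear_intros)+

lemma der_star_der_ash:
  "der_star F y (der_ash a x p) = der_ash a x (der_star F y p) + der_ash a (star F x y) p"
  by (rule der_commutator) (simp only: der_ash_incl der_star_incl star_ash incl_add)

section \<open>Multiplication by a primitive element and associativity\<close>

lemma btl_incl_mult:
  "btl a p (incl u * q) =
    incl u * btl a p q + contract (\<lambda>x. incl (ash a (gen x) u)) (\<lambda>r. btl a r q) p"
  by (rule plinear_eqI[where p = u]; (intro plinear_intros)?)
    (simp only: incl_gen ash_gen btl_gen_mult)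

lemma btl_incl: "btl a p (incl y) = incl y * p + der_ash a y p"
  using btl_incl_mult[of a p y 1] by simp

lemma btl_mult_incl: "btl a (p * q) (incl y) = p * btl a q (incl y) + der_ash a y p * q"
  by (simp only: btl_incl der_mult) (simp add: algebra_simps)

text \<open>Associativity is needed only with a primitive last factor. The left factor is kept
  arbitrary in the induction since pairing \<open>z\<close> removes a factor from it.\<close>

lemma btl_assoc_incl: "btl a (btl a p q) (incl y) = btl a p (btl a q (incl y))"
proof (rule plinear_eqI[where p = q])
  fix N show "btl a (btl a p (gen N)) (incl y) = btl a p (btl a (gen N) (incl y))"
  proof (induction N arbitrary: p)
    case empty
    then show ?case by (simp add: gen_empty btl_incl[of a 1])
  next
    case (add z N)
    have lin: "plinear (\<lambda>r. btl a r (incl y))" by (intro plinear_intros)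
    have btl_add: "btl a p (r + s) = btl a p r + btl a p s" for r s
      by (rule plinear_add) (intro plinear_intros)
    \<comment> \<open>Once \<open>z\<close> is paired with some \<open>x\<close>, the factor
      \<open>y\<close> either multiplies the remaining product or meets the result of that pairing;
      this is \<open>contract_leibniz\<close> with the correction
      \<open>der_ash a y\<close>.\<close>
    have "btl a (btl a p (gen {#z#} * gen N)) (incl y) =
        btl a (gen {#z#} * btl a p (gen N)) (incl y) +
        (contract (\<lambda>x. incl (ash_word a x z)) (\<lambda>r. btl a (btl a r (gen N)) (incl y)) p +
         contract (\<lambda>x. der_ash a y (incl (ash_word a x z))) (\<lambda>r. btl a r (gen N)) p)"
      by (simp only: btl_gen_mult plinear_add[OF lin]
          contract_leibniz[OF lin, of "der_ash a y", OF btl_mult_incl])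
    \<comment> \<open>By \<open>ash_assoc\<close>, letting \<open>y\<close> meet the product of
      \<open>x\<close> and \<open>z\<close> is the same as pairing \<open>x\<close> with the product
      of \<open>z\<close> and \<open>y\<close>.\<close>
    also have "\<dots> = btl a p (gen {#z#} * btl a (gen N) (incl y)) + btl a p (incl (ash a (gen z) y) * gen N)"
      by (simp only: btl_mult_incl btl_gen_mult btl_incl_mult add.IH incl_gen[symmetric] der_ash_incl
          ash_gen[symmetric] ash_assoc) (simp add: algebra_simps)
    also have "\<dots> = btl a p (btl a (gen {#z#} * gen N) (incl y))"
      by (simp only: btl_mult_incl btl_add incl_gen[symmetric] der_ash_incl)
    finally show ?case by (simp only: gen_add_mset[of z N])
  qed
qed (intro plinear_intros)+

section \<open>Sweedler sums\<close>

lemma coprod_gen_mult: "coprod (gen {#g#} * p) = (gen ({#g#}, {#}) + gen ({#}, {#g#})) * coprod p"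
proof (rule plinear_eqI[where p = p])
  show "coprod (gen {#g#} * gen M) = (gen ({#g#}, {#}) + gen ({#}, {#g#})) * coprod (gen M)" for M
    by (simp only: gen_add_mset[symmetric] coprod_def lin_ext_gen image_mset_add_mset prod_mset.add_mset)
qed (unfold coprod_def, (intro plinear_intros)+)

lemma plinear_sweedler [plinear_intros]: "plinear f \<Longrightarrow> plinear (\<lambda>p. sweedler b (f p))"
  unfolding sweedler_def coprod_def by (intro plinear_intros)

lemma plinear_sweedler_fun [plinear_intros]:
  assumes "\<And>A B. plinear (\<lambda>p. b p A B)"
  shows "plinear (\<lambda>p. sweedler (b p) q)"
proof -
  have "plinear (\<lambda>p. case x of (A, B) \<Rightarrow> b p (gen A) (gen B))" for x
    by (cases x) (simp add: assms)
  then show ?thesis unfolding sweedler_def by (intro plinear_intros)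
qed

lemma sweedler_add_fun: "sweedler (\<lambda>A B. b A B + c A B) q = sweedler b q + sweedler c q"
  by (simp add: sweedler_def lin_ext_def split_def poly_mapping.scale_right_distrib sum.distrib)

lemma plinear_sweedler_apply:
  assumes "plinear f"
  shows "f (sweedler b q) = sweedler (\<lambda>A B. f (b A B)) q"
  unfolding sweedler_def by (simp only: lin_ext_compose[OF assms] split_def)

lemma sweedler_one:
  fixes b :: "('v, 'n, 'k::field) sym \<Rightarrow> ('v, 'n, 'k) sym \<Rightarrow> ('v, 'n, 'k) sym"
  shows "sweedler b 1 = b 1 1"
proof -
  have "coprod (gen {#}) = (1 :: (('v list \<times> 'n) multiset \<times> _, 'k) poly_mapping)"
    by (simp only: coprod_def lin_ext_gen image_mset_empty prod_mset_empty)
  also have "\<dots> = gen ({#}, {#})"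
    by (simp only: single_one[symmetric] zero_prod_def)
  finally have "sweedler b (gen {#}) = b (gen {#}) (gen {#})"
    by (simp only: sweedler_def lin_ext_gen prod.case)
  then show ?thesis by (simp only: gen_empty)
qed

text \<open>A generator is primitive, so it joins either the left or the right tensor
  factor.\<close>

lemma sweedler_gen_mult:
  "sweedler b (gen {#g#} * q) =
    sweedler (\<lambda>A B. b (gen {#g#} * A) B) q + sweedler (\<lambda>A B. b A (gen {#g#} * B)) q"
proof -
  let ?E = "\<lambda>b. lin_ext (\<lambda>(A, B). b (gen A) (gen B))"
  have "?E b ((gen ({#g#}, {#}) + gen ({#}, {#g#})) * z) =
      ?E (\<lambda>A B. b (gen {#g#} * A) B) z + ?E (\<lambda>A B. b A (gen {#g#} * B)) z" for z
  proof (rule plinear_eqI[where p = z])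
    fix x :: "('a list \<times> 'b) multiset \<times> ('a list \<times> 'b) multiset"
    obtain A B where x: "x = (A, B)" by (cases x)
    show "?E b ((gen ({#g#}, {#}) + gen ({#}, {#g#})) * gen x) =
      ?E (\<lambda>A B. b (gen {#g#} * A) B) (gen x) + ?E (\<lambda>A B. b A (gen {#g#} * B)) (gen x)"
      by (simp only: x distrib_right gen_plus[symmetric] add_Pair plinear_add[OF plinear_lin_ext]
          lin_ext_gen prod.case add_0)
  qed (intro plinear_intros)+
  then show ?thesis by (simp only: sweedler_def coprod_gen_mult)
qed

lemma sweedler_incl_mult:
  assumes "pbilinear b"
  shows "sweedler b (incl u * q) =
    sweedler (\<lambda>A B. b (incl u * A) B) q + sweedler (\<lambda>A B. b A (incl u * B)) q"
  by (rule plinear_eqI[where p = u];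
      (intro plinear_intros pbilinear_left[OF assms] pbilinear_right[OF assms])?)
    (simp only: incl_gen sweedler_gen_mult)

lemma sweedler_incl: "pbilinear b \<Longrightarrow> sweedler b (incl u) = b (incl u) 1 + b 1 (incl u)"
  using sweedler_incl_mult[of b u 1] by (simp add: sweedler_one)

text \<open>A derivation that sends generators to primitive elements is a coderivation. The bilinear
  map varies in the induction because the factor split off from the monomial is absorbed into one of
  its arguments.\<close>

lemma sweedler_der:
  assumes "pbilinear b"
  shows "sweedler b (der (\<lambda>x. incl (\<psi> x)) q) =
    sweedler (\<lambda>A B. b (der (\<lambda>x. incl (\<psi> x)) A) B + b A (der (\<lambda>x. incl (\<psi> x)) B)) q"
proof -
  let ?d = "der (\<lambda>x. incl (\<psi> x))"
  have "sweedler b (?d (gen N)) = sweedler (\<lambda>A B. b (?d A) B + b A (?d B)) (gen N)" for N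
    using assms
  proof (induction N arbitrary: b)
    case (empty b)
    have "sweedler b 0 = 0" by (rule plinear_0) (intro plinear_intros)
    moreover have "b 0 1 = 0" by (rule plinear_0) (intro pbilinear_left[OF empty] plinear_intros)
    moreover have "b 1 0 = 0" by (rule plinear_0) (intro pbilinear_right[OF empty] plinear_intros)
    ultimately show ?case by (simp add: gen_empty sweedler_one)
  next
    case (add g N)
    note add_left = plinear_add[OF pbilinear_left[OF add.prems plinear_id]]
    note add_right = plinear_add[OF pbilinear_right[OF add.prems plinear_id]]
    have bil: "pbilinear (\<lambda>A B. b (gen {#g#} * A) B)" "pbilinear (\<lambda>A B. b A (gen {#g#} * B))"
      by (intro pbilinearI pbilinear_left[OF add.prems] pbilinear_right[OF add.prems] plinear_intros)+
    have sweedler_add: "sweedler b (p + q) = sweedler b p + sweedler b q" for p q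
      by (rule plinear_add) (intro plinear_intros)
    show ?case
      by (simp only: gen_add_mset[of g N] der_gen_mult sweedler_add sweedler_incl_mult[OF add.prems]
          sweedler_gen_mult add.IH[OF bil(1)] add.IH[OF bil(2)] add_left add_right sweedler_add_fun add_ac)
  qed
  then show ?thesis
    by (intro plinear_eqI[where p = q and f = "\<lambda>q. sweedler b (?d q)"] plinear_intros)
qed

text \<open>Right multiplication by \<open>y\<close>, both for \<open>\<circledast>\<close> and for \<open>\<odot>\<close>, realised on representatives.\<close>

definition right_mult ::
    "('n \<Rightarrow> 'k::field) \<Rightarrow> ('n \<Rightarrow> 'v \<Rightarrow> 'v) \<Rightarrow> ('v, 'n, 'k) tensN \<Rightarrow> ('v, 'n, 'k) sym \<Rightarrow> ('v, 'n, 'k) sym" where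
  "right_mult a F y p = incl y * p + der_ash a y p + der_star F y p"

lemma plinear_right_mult [plinear_intros]: "plinear f \<Longrightarrow> plinear (\<lambda>p. right_mult a F y (f p))"
  unfolding right_mult_def by (intro plinear_intros)

lemma right_mult_btl: "right_mult a F y p = btl a p (incl y) + der_star F y p"
  by (simp only: right_mult_def btl_incl)

text \<open>Multiplication by a primitive element is a coderivation, and so are both derivations by
  \<open>sweedler_der\<close>; hence their sum is one.\<close>

lemma sweedler_right_mult:
  assumes "pbilinear b"
  shows "sweedler b (right_mult a F y q) =
    sweedler (\<lambda>A B. b (right_mult a F y A) B + b A (right_mult a F y B)) q"
proof -
  have "sweedler b (p + q) = sweedler b p + sweedler b q" for p q
    by (rule plinear_add) (intro plinear_intros)
  then show ?thesis
    by (simp only: right_mult_def sweedler_incl_mult[OF assms] sweedler_der[OF assms] sweedler_add_fun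
        plinear_add[OF pbilinear_left[OF assms plinear_id]]
        plinear_add[OF pbilinear_right[OF assms plinear_id]] add_ac)
qed

lemma counit_incl: "counit (incl u) = 0"
  by (simp add: counit_def incl_def lin_ext_def lookup_sum lookup_single)

text \<open>
  The given extensions are bilinear only up to \<open>sym_eq\<close>; \<open>bilinearize\<close> replaces them by exactly
  bilinear maps, as the Sweedler computations above require.
\<close>

definition bilinearize ::
    "(('a, 'k::field) poly_mapping \<Rightarrow> ('b, 'k) poly_mapping \<Rightarrow> ('c, 'k) poly_mapping) \<Rightarrow>
      ('a, 'k) poly_mapping \<Rightarrow> ('b, 'k) poly_mapping \<Rightarrow> ('c, 'k) poly_mapping" where
  "bilinearize b = bilin_ext (\<lambda>x y. b (gen x) (gen y))"

lemma pbilinear_bilinearize: "pbilinear (bilinearize b)"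
  unfolding bilinearize_def by (rule pbilinear_bilin_ext)

lemmas plinear_bilinearize [plinear_intros] =
  pbilinear_left[OF pbilinear_bilinearize] pbilinear_right[OF pbilinear_bilinearize]

section \<open>Equality in the symmetric algebra\<close>

text \<open>A shuffle moves the letter \<open>z\<close> without looking at it. So the result is a
  fixed combination \<open>T\<close> of pairs of words surrounding \<open>z\<close>, which makes its
  dependence on \<open>z\<close> multilinear modulo the ideal.\<close>

lemma sh_word_letter:
  "\<exists>T. \<forall>z. sh_word (u @ z # w) v = (lin_ext (\<lambda>(p, q). gen (p @ z # q)) T :: ('v, 'k::field) tens)"
proof -
  let ?L = "\<lambda>z. lin_ext (\<lambda>(p, q). gen (p @ z # q)) :: (_, 'k) poly_mapping \<Rightarrow> ('v, 'k) tens"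
  \<comment> \<open>The marked letter stands behind the first letter of a word (\<open>pre\<close>)
    or is itself the first (\<open>first\<close>).\<close>
  have pre: "prefix_letter x (?L z T) = ?L z (lin_ext (\<lambda>(p, q). gen (x # p, q)) T)" for x z T
    by (rule plinear_eqI[where p = T]; (intro plinear_intros)?) (auto simp: prefix_letter_gen)
  have first: "prefix_letter z p = ?L z (lin_ext (\<lambda>q. gen ([], q)) p)" for z p
    by (rule plinear_eqI[where p = p]; (intro plinear_intros)?) (auto simp: prefix_letter_gen)
  have add: "?L z S + ?L z T = ?L z (S + T)" for z S T
    by (simp only: plinear_add[OF plinear_lin_ext])
  show ?thesis
  proof (induction "length u + length v" arbitrary: u v rule: less_induct)
    case less
    show ?case
    proof (cases v)
      case Nil
      show ?thesis unfolding Nil by (rule exI[of _ "gen (u, w)"]) simp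
    next
      case v: (Cons y v')
      obtain T where T: "\<And>z. sh_word (u @ z # w) v' = ?L z T"
        using less[of u v'] v by auto
      show ?thesis
      proof (cases u)
        case Nil
        have "sh_word (u @ z # w) v = ?L z (lin_ext (\<lambda>q. gen ([], q)) (sh_word w v) +
            lin_ext (\<lambda>(p, q). gen (y # p, q)) T)" for z
          using T[of z] unfolding add[symmetric] pre[symmetric] first[symmetric]
          by (simp add: Nil v prefix_letter_def[symmetric])
        then show ?thesis by blast
      next
        case (Cons x u')
        obtain S where "\<And>z. sh_word (u' @ z # w) v = ?L z S"
          using less[of u' v] Cons by auto
        then have "sh_word (u @ z # w) v = ?L z (lin_ext (\<lambda>(p, q). gen (x # p, q)) S +
            lin_ext (\<lambda>(p, q). gen (y # p, q)) T)" for z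
          using T[of z] unfolding add[symmetric] pre[symmetric]
          by (simp add: Cons v prefix_letter_def[symmetric])
        then show ?thesis by blast
      qed
    qed
  qed
qed

text \<open>The generators of the ideal before \<open>incl\<close> is applied, so that they can be
  inserted into \<open>ash\<close>.\<close>

definition multilin_relators :: "('k::field \<Rightarrow> 'v::ab_group_add \<Rightarrow> 'v) \<Rightarrow> ('v, 'n, 'k) tensN set" where
  "multilin_relators scale =
    {gen (u @ (x + y) # w, i) - gen (u @ x # w, i) - gen (u @ y # w, i) | u x y w i. True} \<union>
    {gen (u @ scale c x # w, i) - pscale c (gen (u @ x # w, i)) | u c x w i. True}"

context
  fixes scale :: "'k::field \<Rightarrow> 'v::ab_group_add \<Rightarrow> 'v"
begin

abbreviation (input) sym_eq_infix :: "('v, 'n, 'k) sym \<Rightarrow> ('v, 'n, 'k) sym \<Rightarrow> bool" (infix "\<approx>" 50) where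
  "P \<approx> Q \<equiv> sym_eq scale P Q"

section \<open>Congruence rules modulo the ideal\<close>

lemma ideal_zero: "0 \<in> multilin_ideal scale"
  using multilin_ideal.mult[where R = 0, OF multilin_ideal.homogeneous[of _ scale]] by simp

lemma ideal_pscale: "P \<in> multilin_ideal scale \<Longrightarrow> pscale c P \<in> multilin_ideal scale"
  unfolding pscale_conv_mult by (rule multilin_ideal.mult)

lemma ideal_mult_right: "P \<in> multilin_ideal scale \<Longrightarrow> P * R \<in> multilin_ideal scale"
  by (subst mult.commute) (rule multilin_ideal.mult)

lemma ideal_uminus: "P \<in> multilin_ideal scale \<Longrightarrow> - P \<in> multilin_ideal scale"
  using multilin_ideal.mult[of P scale "- 1"] by simp

lemma ideal_diff: "P \<in> multilin_ideal scale \<Longrightarrow> Q \<in> multilin_ideal scale \<Longrightarrow> P - Q \<in> multilin_ideal scale"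
  using multilin_ideal.add[of P scale "- Q"] ideal_uminus[of Q] by simp

lemma ideal_sum_mset:
  "(\<And>x. x \<in># M \<Longrightarrow> f x \<in> multilin_ideal scale) \<Longrightarrow> (\<Sum>x\<in>#M. f x) \<in> multilin_ideal scale"
  by (induction M) (auto intro: ideal_zero multilin_ideal.add)

lemma ideal_plinearI:
  assumes "plinear f" "\<And>x. f (gen x) \<in> multilin_ideal scale"
  shows "f p \<in> multilin_ideal scale"
proof -
  have "(\<Sum>x\<in>A. pscale (c x) (f (gen x))) \<in> multilin_ideal scale" if "finite A" for A c
    using that by induction (auto intro: ideal_zero multilin_ideal.add ideal_pscale assms(2))
  then show ?thesis
    by (subst plinear_eq_lin_ext[OF assms(1)]) (simp add: lin_ext_def)
qed

lemma sym_eq_refl [simp, intro]: "P \<approx> P"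
  by (simp add: sym_eq_def ideal_zero)

lemma sym_eq_sym: "P \<approx> Q \<Longrightarrow> Q \<approx> P"
  using ideal_uminus[of "P - Q"] by (simp add: sym_eq_def)

lemma sym_eq_trans [trans]: "P \<approx> Q \<Longrightarrow> Q \<approx> R \<Longrightarrow> P \<approx> R"
  using multilin_ideal.add[of "P - Q" scale "Q - R"] by (simp add: sym_eq_def)

lemma sym_eq_add: "P \<approx> P' \<Longrightarrow> Q \<approx> Q' \<Longrightarrow> P + Q \<approx> P' + Q'"
  using multilin_ideal.add[of "P - P'" scale "Q - Q'"] by (simp add: sym_eq_def algebra_simps)

lemma sym_eq_diff: "P \<approx> P' \<Longrightarrow> Q \<approx> Q' \<Longrightarrow> P - Q \<approx> P' - Q'"
  using ideal_diff[of "P - P'" "Q - Q'"] by (simp add: sym_eq_def algebra_simps)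

lemma sym_eq_mult: "P \<approx> P' \<Longrightarrow> Q \<approx> Q' \<Longrightarrow> P * Q \<approx> P' * Q'"
  using multilin_ideal.add[OF ideal_mult_right[of "P - P'" Q] multilin_ideal.mult[of "Q - Q'" scale P']]
  by (simp add: sym_eq_def algebra_simps)

lemma sym_eq_plinearI:
  assumes "plinear f" "plinear g" "\<And>x. f (gen x) \<approx> g (gen x)"
  shows "f p \<approx> g p"
  unfolding sym_eq_def
  by (rule ideal_plinearI[of "\<lambda>p. f p - g p"])
    (use assms in \<open>auto simp: sym_eq_def intro: plinear_minus\<close>)

lemma ideal_contract:
  assumes "\<And>x r. \<phi> x * L r \<in> multilin_ideal scale"
  shows "contract \<phi> L p \<in> multilin_ideal scale"
proof (rule ideal_plinearI[where f = "contract \<phi> L"])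
  show "contract \<phi> L (gen M) \<in> multilin_ideal scale" for M
    unfolding contract_gen by (intro ideal_sum_mset assms)
qed (intro plinear_intros)

section \<open>Compatibility of \<open>btl\<close> with multilinearity\<close>

lemma incl_multilin_relators: "r \<in> multilin_relators scale \<Longrightarrow> incl r \<in> multilin_ideal scale"
  unfolding multilin_relators_def by (auto intro: multilin_ideal.additive multilin_ideal.homogeneous)

text \<open>Each pair of words in \<open>T\<close> contributes a scalar multiple of a defining
  relation. \<open>G\<close> stands for an \<open>ash\<close> product as a function of one letter of
  one of its words.\<close>

lemma ideal_letter:
  fixes G :: "'v \<Rightarrow> ('v, 'n, 'k) tensN"
  assumes "\<And>z. G z = pscale c (tag j (lin_ext (\<lambda>(p, q). gen (p @ z # q)) T))"
  shows "incl (G (x + y) - G x - G y) \<in> multilin_ideal scale"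
    and "incl (G (scale b x) - pscale b (G x)) \<in> multilin_ideal scale"
proof -
  let ?H = "\<lambda>z T. pscale c (tag j (lin_ext (\<lambda>(p, q). gen (p @ z # q)) T)) :: ('v, 'n, 'k) tensN"
  have gen: "?H z (gen (p, q)) = pscale c (gen (p @ z # q, j))" for z p q
    by (simp add: tag_gen)
  have "incl (?H (x + y) T - ?H x T - ?H y T) \<in> multilin_ideal scale"
  proof (rule ideal_plinearI[where p = T])
    fix t :: "'v list \<times> 'v list"
    obtain p q where t: "t = (p, q)" by (cases t)
    have "pscale c (incl (gen (p @ (x + y) # q, j) - gen (p @ x # q, j) - gen (p @ y # q, j)))
        \<in> multilin_ideal scale"
      by (intro ideal_pscale multilin_ideal.additive)
    then show "incl (?H (x + y) (gen t) - ?H x (gen t) - ?H y (gen t)) \<in> multilin_ideal scale"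
      unfolding t gen by (simp only: plinear_scale[OF plinear_incl[OF plinear_id], symmetric]
        poly_mapping.scale_right_diff_distrib)
  qed (intro plinear_intros)
  then show "incl (G (x + y) - G x - G y) \<in> multilin_ideal scale"
    by (simp only: assms)
  have "incl (?H (scale b x) T - pscale b (?H x T)) \<in> multilin_ideal scale"
  proof (rule ideal_plinearI[where p = T])
    fix t :: "'v list \<times> 'v list"
    obtain p q where t: "t = (p, q)" by (cases t)
    have "pscale c (incl (gen (p @ scale b x # q, j) - pscale b (gen (p @ x # q, j))))
        \<in> multilin_ideal scale"
      by (intro ideal_pscale multilin_ideal.homogeneous)
    then show "incl (?H (scale b x) (gen t) - pscale b (?H x (gen t))) \<in> multilin_ideal scale"
      unfolding t gen by (simp only: plinear_scale[OF plinear_incl[OF plinear_id], symmetric]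
        poly_mapping.scale_right_diff_distrib poly_mapping.scale_scale mult.commute[of b])
  qed (intro plinear_intros)
  then show "incl (G (scale b x) - pscale b (G x)) \<in> multilin_ideal scale"
    by (simp only: assms)
qed

lemma incl_ash_relator_left:
  assumes "r \<in> multilin_relators scale"
  shows "incl (ash a r (gen y)) \<in> multilin_ideal scale"
proof -
  obtain g j where y: "y = (g, j)" by (cases y)
  have *: "\<exists>T. \<forall>z. ash a (gen (u @ z # w, i)) (gen y) =
      pscale (a i) (tag j (lin_ext (\<lambda>(p, q). gen (p @ z # q)) T))" for u w i
    using sh_word_letter[of u w g] unfolding y ash_gen ash_word.simps tag_def by metis
  show ?thesis
    using assms unfolding multilin_relators_def
  proof (elim UnE CollectE exE conjE)
    fix u x x' w i assume r: "r = gen (u @ (x + x') # w, i) - gen (u @ x # w, i) - gen (u @ x' # w, i)"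
    obtain T where "\<And>z. ash a (gen (u @ z # w, i)) (gen y) =
        pscale (a i) (tag j (lin_ext (\<lambda>(p, q). gen (p @ z # q)) T))" using *[of u w i] by blast
    from ideal_letter(1)[OF this] show ?thesis
      by (simp only: r plinear_diff[OF plinear_ash(1)[OF plinear_id]])
  next
    fix u c x w i assume r: "r = gen (u @ scale c x # w, i) - pscale c (gen (u @ x # w, i))"
    obtain T where "\<And>z. ash a (gen (u @ z # w, i)) (gen y) =
        pscale (a i) (tag j (lin_ext (\<lambda>(p, q). gen (p @ z # q)) T))" using *[of u w i] by blast
    from ideal_letter(2)[OF this] show ?thesis
      by (simp only: r plinear_diff[OF plinear_ash(1)[OF plinear_id]] plinear_scale[OF plinear_ash(1)[OF plinear_id]])
  qed
qed

lemma incl_ash_relator_right: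
  assumes "r \<in> multilin_relators scale"
  shows "incl (ash a (gen y) r) \<in> multilin_ideal scale"
proof -
  obtain g j where y: "y = (g, j)" by (cases y)
  \<comment> \<open>Commutativity brings the word with the marked letter to the left of the shuffle,
    where \<open>sh_word_letter\<close> applies.\<close>
  have *: "\<exists>T. \<forall>z. ash a (gen y) (gen (u @ z # w, i)) =
      pscale (a j) (tag i (lin_ext (\<lambda>(p, q). gen (p @ z # q)) T))" for u w i
    using sh_word_letter[of u w g] unfolding y ash_gen ash_word.simps tag_def sh_word_commute[of g] by metis
  show ?thesis
    using assms unfolding multilin_relators_def
  proof (elim UnE CollectE exE conjE)
    fix u x x' w i assume r: "r = gen (u @ (x + x') # w, i) - gen (u @ x # w, i) - gen (u @ x' # w, i)"
    obtain T where "\<And>z. ash a (gen y) (gen (u @ z # w, i)) =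
        pscale (a j) (tag i (lin_ext (\<lambda>(p, q). gen (p @ z # q)) T))" using *[of u w i] by blast
    from ideal_letter(1)[OF this] show ?thesis
      by (simp only: r plinear_diff[OF plinear_ash(2)[OF plinear_id]])
  next
    fix u c x w i assume r: "r = gen (u @ scale c x # w, i) - pscale c (gen (u @ x # w, i))"
    obtain T where "\<And>z. ash a (gen y) (gen (u @ z # w, i)) =
        pscale (a j) (tag i (lin_ext (\<lambda>(p, q). gen (p @ z # q)) T))" using *[of u w i] by blast
    from ideal_letter(2)[OF this] show ?thesis
      by (simp only: r plinear_diff[OF plinear_ash(2)[OF plinear_id]] plinear_scale[OF plinear_ash(2)[OF plinear_id]])
  qed
qed

text \<open>While the factors of the right monomial are treated, the relator is either carried along
  untouched or paired with one of them, and then \<open>incl_ash_relator_left\<close>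
  applies.\<close>

lemma btl_relator_left:
  assumes r: "r \<in> multilin_relators scale"
  shows "btl a (incl r * p) q \<in> multilin_ideal scale"
proof (rule ideal_plinearI[where p = q])
  fix N show "btl a (incl r * p) (gen N) \<in> multilin_ideal scale"
  proof (induction N arbitrary: p)
    case empty
    show ?case using r by (simp add: gen_empty ideal_mult_right incl_multilin_relators)
  next
    case (add z N)
    have lin: "plinear (\<lambda>p. btl a p (gen N))" by (intro plinear_intros)
    have "lin_ext (\<lambda>x. incl (ash_word a x z)) r = incl (ash a r (gen z))"
      by (rule plinear_eqI[where p = r]; (intro plinear_intros)?) (simp add: ash_gen)
    then show ?case
      unfolding gen_add_mset[of z N] btl_gen_mult contract_incl_mult[OF lin]
      by (intro multilin_ideal.add multilin_ideal.mult ideal_mult_right add.IH ideal_contract)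
        (simp only: incl_ash_relator_left[OF r])
  qed
qed (intro plinear_intros)

lemma btl_relator_right:
  assumes r: "r \<in> multilin_relators scale"
  shows "btl a p (incl r * q) \<in> multilin_ideal scale"
  unfolding btl_incl_mult
  by (intro multilin_ideal.add ideal_mult_right ideal_contract incl_ash_relator_right r incl_multilin_relators)

text \<open>The cofactor \<open>R\<close> is built into the claim because \<open>btl\<close> does
  not pull out commutative factors; without it the induction would stop at the clause for
  multiples.\<close>

lemma btl_ideal:
  assumes "P \<in> multilin_ideal scale"
  shows "btl a (R * P) Q \<in> multilin_ideal scale \<and> btl a Q (R * P) \<in> multilin_ideal scale"
proof -
  have relator: "btl a (R * incl r) Q \<in> multilin_ideal scale \<and> btl a Q (R * incl r) \<in> multilin_ideal scale"
    if "r \<in> multilin_relators scale" for R r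
    using btl_relator_left[OF that, of a R Q] btl_relator_right[OF that, of a Q R]
    by (simp only: mult.commute[of R] simp_thms)
  show ?thesis using assms
  proof (induction arbitrary: R)
    case additive
    show ?case by (rule relator) (unfold multilin_relators_def, blast)
  next
    case homogeneous
    show ?case by (rule relator) (unfold multilin_relators_def, blast)
  next
    case (add P P')
    then show ?case
      by (simp only: distrib_left plinear_add[OF plinear_btl(1)[OF plinear_id]]
          plinear_add[OF plinear_btl(2)[OF plinear_id]]) (blast intro: multilin_ideal.add)
  next
    case (mult P S)
    from mult.IH[of "R * S"] show ?case by (simp only: mult.assoc)
  qed
qed

lemma sym_eq_btl:
  assumes "P \<approx> P'" "Q \<approx> Q'"
  shows "btl a P Q \<approx> btl a P' Q'"
proof -
  have "btl a P Q - btl a P' Q \<in> multilin_ideal scale" "btl a P' Q - btl a P' Q' \<in> multilin_ideal scale"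
    using assms btl_ideal[of "P - P'" a 1 Q] btl_ideal[of "Q - Q'" a 1 P']
    by (simp_all add: sym_eq_def plinear_diff[OF plinear_btl(1)[OF plinear_id]]
        plinear_diff[OF plinear_btl(2)[OF plinear_id]])
  from multilin_ideal.add[OF this] show ?thesis by (simp add: sym_eq_def)
qed

section \<open>From operations bilinear modulo the ideal to bilinear ones\<close>

lemma sym_eq_lin_ext: "(\<And>x. f x \<approx> g x) \<Longrightarrow> lin_ext f p \<approx> lin_ext g p"
  by (rule sym_eq_plinearI) (simp_all add: plinear_lin_ext)

lemma sym_eq_sweedler:
  "(\<And>A B. b (gen A) (gen B) \<approx> c (gen A) (gen B)) \<Longrightarrow> sweedler b q \<approx> sweedler c q"
  unfolding sweedler_def by (rule sym_eq_lin_ext) auto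

lemma sym_eq_lin_ext_gen:
  fixes f :: "('v, 'n, 'k) sym \<Rightarrow> ('v, 'n, 'k) sym"
  assumes "\<And>p q. f (p + q) \<approx> f p + f q" "\<And>c p. f (pscale c p) \<approx> pscale c (f p)"
  shows "f p \<approx> lin_ext (\<lambda>x. f (gen x)) p"
proof -
  have "f (\<Sum>x\<in>A. pscale (c x) (gen x)) \<approx> (\<Sum>x\<in>A. pscale (c x) (f (gen x)))" if "finite A" for A c
    using that
  proof induction
    case empty
    show ?case using assms(2)[of 0 0] by simp
  next
    case (insert x A)
    have "f (pscale (c x) (gen x) + (\<Sum>x\<in>A. pscale (c x) (gen x))) \<approx>
        f (pscale (c x) (gen x)) + f (\<Sum>x\<in>A. pscale (c x) (gen x))"
      by (rule assms)
    also have "\<dots> \<approx> pscale (c x) (f (gen x)) + (\<Sum>x\<in>A. pscale (c x) (f (gen x)))"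
      by (intro sym_eq_add assms insert.IH)
    finally show ?case using insert.hyps by simp
  qed
  from this[of "Poly_Mapping.keys p" "Poly_Mapping.lookup p"]
  have "f (lin_ext gen p) \<approx> lin_ext (\<lambda>x. f (gen x)) p" by (simp only: lin_ext_def finite_keys simp_thms)
  then show ?thesis by (simp only: poly_mapping_eq_lin_ext_gen)
qed

lemma sym_eq_bilinearize:
  assumes "sym_bilinear scale b"
  shows "b P Q \<approx> bilinearize b P Q"
proof -
  note b = assms[unfolded sym_bilinear_def]
  have "b P Q \<approx> lin_ext (\<lambda>x. b (gen x) Q) P"
    using b by (intro sym_eq_lin_ext_gen[of "\<lambda>P. b P Q"]) auto
  also have "\<dots> \<approx> lin_ext (\<lambda>x. lin_ext (\<lambda>y. b (gen x) (gen y)) Q) P"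
    using b by (intro sym_eq_lin_ext sym_eq_lin_ext_gen[of "b (gen x)" for x]) auto
  finally show ?thesis by (simp only: bilinearize_def bilin_ext_def)
qed

lemma sym_bilinear_cong:
  "sym_bilinear scale b \<Longrightarrow> P \<approx> P' \<Longrightarrow> Q \<approx> Q' \<Longrightarrow> b P Q \<approx> b P' Q'"
  unfolding sym_bilinear_def by blast

text \<open>A derivation maps a monomial to a combination of monomials of the same degree.\<close>

lemma sym_eq_der_gen:
  assumes "plinear f" "plinear g"
    and deg: "\<And>N. size N = size M \<Longrightarrow> f (gen N) \<approx> g (gen N)"
  shows "f (der (\<lambda>x. incl (\<psi> x)) (gen M)) \<approx> g (der (\<lambda>x. incl (\<psi> x)) (gen M))"
proof -
  let ?h = "\<lambda>p. f p - g p"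
  have h: "plinear ?h" by (rule plinear_minus) fact+
  have "?h (incl (\<psi> x) * gen (M - {#x#})) \<in> multilin_ideal scale" if "x \<in># M" for x
  proof (rule ideal_plinearI[where f = "\<lambda>u. ?h (incl u * gen (M - {#x#}))"])
    show "plinear (\<lambda>u. ?h (incl u * gen (M - {#x#})))"
      by (rule plinear_compose[OF h]) (intro plinear_intros)
    show "?h (incl (gen y) * gen (M - {#x#})) \<in> multilin_ideal scale" for y
    proof -
      have "size (add_mset y (M - {#x#})) = size M" using that by (simp add: size_Suc_Diff1)
      from deg[OF this] show ?thesis
        by (simp only: sym_eq_def gen_add_mset[of y "M - {#x#}"] incl_gen)
    qed
  qed
  then show ?thesis
    unfolding sym_eq_def contract_gen by (subst plinear_sum_mset_apply[OF h]) (rule ideal_sum_mset)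
qed

section \<open>The two extensions at a primitive right argument\<close>

text \<open>Because \<open>y\<close> is primitive, \<open>st _ (incl y)\<close> is a derivation for
  \<open>btl\<close>, prescribed on generators. By \<open>der_star_der_ash\<close>,
  \<open>der_star F y\<close> obeys the same rule, so the two agree by induction on the
  degree.\<close>

lemma star_extension_incl:
  assumes "is_star_extension scale a F st"
  shows "st P (incl y) \<approx> der_star F y P"
proof -
  have bil: "sym_bilinear scale st"
    and gens: "\<And>u v. st (incl u) (incl v) \<approx> incl (star F u v)"
    and one_right: "\<And>P. st P 1 \<approx> P"
    and one_left: "\<And>P. st 1 P \<approx> pscale (counit P) 1"
    and prod_left: "\<And>P Q R. st (btl a P Q) R \<approx> sweedler (\<lambda>R1 R2. btl a (st P R1) (st Q R2)) R"
    using assms unfolding is_star_extension_def by blast+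
  let ?s = "bilinearize st"
  have s: "st P Q \<approx> ?s P Q" for P Q by (rule sym_eq_bilinearize[OF bil])
  note s' = sym_eq_sym[OF s]
  have lin: "plinear (\<lambda>p. ?s p (incl y))" "plinear (\<lambda>p. der_star F y p)"
    by (intro plinear_intros)+
  have "?s (gen M) (incl y) \<approx> der_star F y (gen M)" for M
  proof (induction "size M" arbitrary: M)
    case 0
    have "?s 1 (incl y) \<approx> st 1 (incl y)" by (rule s')
    also have "\<dots> \<approx> 0" using one_left[of "incl y"] by (simp add: counit_incl)
    finally show ?case using 0 by (simp add: gen_empty)
  next
    case (Suc n)
    then obtain x N where M: "M = add_mset x N" and n: "size N = n"
      by (cases M) auto
    let ?x = "gen x" and ?P = "gen N" and ?d = "der_star F y"
    have IH: "?s (gen N') (incl y) \<approx> ?d (gen N')" if "size N' = size N" for N'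
      using Suc(1)[of N'] that n by simp
    have "?s (btl a ?P (incl ?x)) (incl y) \<approx> st (btl a ?P (incl ?x)) (incl y)" by (rule s')
    also have "\<dots> \<approx> sweedler (\<lambda>A B. btl a (st ?P A) (st (incl ?x) B)) (incl y)" by (rule prod_left)
    also have "\<dots> \<approx> sweedler (\<lambda>A B. btl a (?s ?P A) (?s (incl ?x) B)) (incl y)"
      by (intro sym_eq_sweedler sym_eq_btl s)
    also have "\<dots> = btl a (?s ?P (incl y)) (?s (incl ?x) 1) + btl a (?s ?P 1) (?s (incl ?x) (incl y))"
      by (rule sweedler_incl) (intro pbilinearI plinear_intros)
    also have "\<dots> \<approx> btl a (?d ?P) (incl ?x) + btl a ?P (incl (star F ?x y))"
      by (intro sym_eq_add sym_eq_btl IH refl sym_eq_trans[OF s' one_right] sym_eq_trans[OF s' gens])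
    finally have btl: "?s (btl a ?P (incl ?x)) (incl y) \<approx> \<dots>" .
    have der: "?s (der_ash a ?x ?P) (incl y) \<approx> ?d (der_ash a ?x ?P)"
      by (rule sym_eq_der_gen[OF lin IH])
    \<comment> \<open>The commutative product is the \<open>btl\<close> product minus a correction
      of lower degree, to which the induction hypothesis applies through
      \<open>sym_eq_der_gen\<close>.\<close>
    have "gen M = btl a ?P (incl ?x) - der_ash a ?x ?P"
      unfolding M gen_add_mset[of x N] btl_incl by (simp add: incl_gen)
    then have "?s (gen M) (incl y) = ?s (btl a ?P (incl ?x)) (incl y) - ?s (der_ash a ?x ?P) (incl y)"
      by (simp only: plinear_diff[OF lin(1)])
    also have "\<dots> \<approx> btl a (?d ?P) (incl ?x) + btl a ?P (incl (star F ?x y)) - ?d (der_ash a ?x ?P)"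
      by (rule sym_eq_diff[OF btl der])
    \<comment> \<open>The terms with \<open>der_ash\<close> cancel by the commutator formula; what
      remains is the Leibniz rule for \<open>d\<close>.\<close>
    also have "\<dots> = ?d (gen M)"
      unfolding M gen_add_mset[of x N] der_gen_mult der_star_der_ash btl_incl
      by (simp add: incl_gen algebra_simps)
    finally show ?case .
  qed
  then have "?s P (incl y) \<approx> der_star F y P"
    by (rule sym_eq_plinearI[OF lin])
  then show ?thesis by (rule sym_eq_trans[OF s])
qed

text \<open>Here \<open>bu _ (incl y)\<close> is a derivation of the commutative product itself, so
  its values on generators, where \<open>bullet\<close> is the sum of \<open>star\<close> and
  \<open>ash\<close>, decide. Induction on the monomial suffices.\<close>

lemma bullet_extension_incl:
  assumes "is_bullet_extension scale a F bu"
  shows "bu P (incl y) \<approx> der_ash a y P + der_star F y P"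
proof -
  have bil: "sym_bilinear scale bu"
    and gens: "\<And>u v. bu (incl u) (incl v) \<approx> incl (bullet a F u v)"
    and one_right: "\<And>P. bu P 1 \<approx> P"
    and one_left: "\<And>P. bu 1 P \<approx> pscale (counit P) 1"
    and prod_left: "\<And>P Q R. bu (P * Q) R \<approx> sweedler (\<lambda>R1 R2. bu P R1 * bu Q R2) R"
    using assms unfolding is_bullet_extension_def by blast+
  let ?b = "bilinearize bu" and ?d = "\<lambda>P. der_ash a y P + der_star F y P"
  have b: "bu P Q \<approx> ?b P Q" for P Q by (rule sym_eq_bilinearize[OF bil])
  note b' = sym_eq_sym[OF b]
  have lin: "plinear (\<lambda>p. ?b p (incl y))" "plinear ?d"
    by (intro plinear_intros)+
  have "?b (gen M) (incl y) \<approx> ?d (gen M)" for M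
  proof (induction M)
    case empty
    have "?b 1 (incl y) \<approx> bu 1 (incl y)" by (rule b')
    also have "\<dots> \<approx> 0" using one_left[of "incl y"] by (simp add: counit_incl)
    finally show ?case by (simp add: gen_empty)
  next
    case (add x N)
    let ?x = "gen x" and ?P = "gen N"
    have "?b (incl ?x * ?P) (incl y) \<approx> bu (incl ?x * ?P) (incl y)" by (rule b')
    also have "\<dots> \<approx> sweedler (\<lambda>A B. bu (incl ?x) A * bu ?P B) (incl y)" by (rule prod_left)
    also have "\<dots> \<approx> sweedler (\<lambda>A B. ?b (incl ?x) A * ?b ?P B) (incl y)"
      by (intro sym_eq_sweedler sym_eq_mult b)
    also have "\<dots> = ?b (incl ?x) (incl y) * ?b ?P 1 + ?b (incl ?x) 1 * ?b ?P (incl y)"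
      by (rule sweedler_incl) (intro pbilinearI plinear_intros)
    also have "\<dots> \<approx> incl (bullet a F ?x y) * ?P + incl ?x * ?d ?P"
      by (intro sym_eq_add sym_eq_mult add.IH sym_eq_trans[OF b' one_right] sym_eq_trans[OF b' gens])
    also have "\<dots> = ?d (gen {#x#} * ?P)"
      by (simp only: der_gen_mult bullet_def incl_add incl_gen) (simp add: algebra_simps)
    finally show ?case by (simp only: gen_add_mset[of x N] incl_gen)
  qed
  then have "?b P (incl y) \<approx> ?d P"
    by (rule sym_eq_plinearI[OF lin])
  then show ?thesis by (rule sym_eq_trans[OF b])
qed

section \<open>Commutation of both products with right multiplication\<close>

lemma circledast_bilinearize:
  assumes "sym_bilinear scale st"
  shows "circledast a st P Q \<approx> sweedler (\<lambda>A B. btl a (bilinearize st P A) B) Q"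
  unfolding circledast_def
  by (intro sym_eq_sweedler sym_eq_btl sym_eq_bilinearize assms sym_eq_refl)

lemma odot_bilinearize:
  assumes "sym_bilinear scale bu"
  shows "odot bu P Q \<approx> sweedler (\<lambda>A B. bilinearize bu P A * B) Q"
  unfolding odot_def
  by (intro sym_eq_sweedler sym_eq_mult sym_eq_bilinearize assms sym_eq_refl)

text \<open>This is the associativity of \<circledast> with last factor \<open>y\<close>: the left
  side stands for the product of \<open>P\<close> with \<open>Q\<close> times \<open>y\<close>, the
  right side for the product of \<open>P\<close> and \<open>Q\<close>, times
  \<open>y\<close>.\<close>

lemma sweedler_star_right_mult:
  fixes P :: "('v, 'n, 'k) sym"
  assumes "is_star_extension scale a F st"
  defines "b \<equiv> \<lambda>A B. btl a (bilinearize st P A) B"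
  shows "sweedler b (right_mult a F y Q) \<approx> right_mult a F y (sweedler b Q)"
proof -
  have bil: "sym_bilinear scale st"
    and one_right: "\<And>P. st P 1 \<approx> P"
    and prod_right: "\<And>P Q y. st P (btl a Q (incl y)) \<approx> st (st P Q) (incl y) - st P (st Q (incl y))"
    and prod_left: "\<And>P Q R. st (btl a P Q) R \<approx> sweedler (\<lambda>R1 R2. btl a (st P R1) (st Q R2)) R"
    using assms(1) unfolding is_star_extension_def by blast+
  let ?s = "bilinearize st" and ?d = "der_star F y"
  note cong = sym_bilinear_cong[OF bil]
  note incl = star_extension_incl[OF assms(1), of _ y]
  have s: "st P Q \<approx> ?s P Q" for P Q by (rule sym_eq_bilinearize[OF bil])
  note s' = sym_eq_sym[OF s]
  have b: "pbilinear b" unfolding b_def by (intro pbilinearI plinear_intros)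
  \<comment> \<open>The rule for a right argument \<open>btl a A (incl y)\<close> subtracts exactly
    the term that the summand \<open>?d A\<close> of \<open>right_mult a F y A\<close> adds.\<close>
  have left: "?s P (right_mult a F y A) \<approx> ?d (?s P A)" for A
  proof -
    have "?s P (right_mult a F y A) = ?s P (btl a A (incl y)) + ?s P (?d A)"
      unfolding right_mult_btl by (rule plinear_add) (intro plinear_intros)
    also have "\<dots> \<approx> (st (st P A) (incl y) - st P (st A (incl y))) + st P (?d A)"
      by (intro sym_eq_add sym_eq_trans[OF s' prod_right] s')
    also have "\<dots> \<approx> (st (?s P A) (incl y) - st P (?d A)) + st P (?d A)"
      by (intro sym_eq_add sym_eq_diff cong s incl sym_eq_refl)
    also have "\<dots> = st (?s P A) (incl y)" by simp
    also have "\<dots> \<approx> ?d (?s P A)" by (rule incl)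
    finally show ?thesis .
  qed
  \<comment> \<open>The coproduct of a primitive \<open>y\<close> has two terms, so the rule for a
    left argument \<open>btl a Z B\<close> becomes a Leibniz rule for \<open>d\<close>.\<close>
  have leibniz: "?d (btl a Z B) \<approx> btl a (?d Z) B + btl a Z (?d B)" for Z B
  proof -
    have "?d (btl a Z B) \<approx> st (btl a Z B) (incl y)" by (rule sym_eq_sym[OF incl])
    also have "\<dots> \<approx> sweedler (\<lambda>R1 R2. btl a (st Z R1) (st B R2)) (incl y)" by (rule prod_left)
    also have "\<dots> \<approx> sweedler (\<lambda>R1 R2. btl a (?s Z R1) (?s B R2)) (incl y)"
      by (intro sym_eq_sweedler sym_eq_btl s)
    also have "\<dots> = btl a (?s Z (incl y)) (?s B 1) + btl a (?s Z 1) (?s B (incl y))"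
      by (rule sweedler_incl) (intro pbilinearI plinear_intros)
    also have "\<dots> \<approx> btl a (?d Z) B + btl a Z (?d B)"
      by (intro sym_eq_add sym_eq_btl sym_eq_trans[OF s' one_right] sym_eq_trans[OF s' incl])
    finally show ?thesis .
  qed
  have "b (right_mult a F y A) B + b A (right_mult a F y B) \<approx> right_mult a F y (b A B)" for A B
  proof -
    let ?Z = "?s P A"
    have "b (right_mult a F y A) B + b A (right_mult a F y B) \<approx>
        btl a (?d ?Z) B + btl a ?Z (right_mult a F y B)"
      unfolding b_def by (intro sym_eq_add sym_eq_btl left sym_eq_refl)
    also have "btl a ?Z (right_mult a F y B) = btl a (btl a ?Z B) (incl y) + btl a ?Z (?d B)"
      unfolding right_mult_btl btl_assoc_incl by (rule plinear_add) (intro plinear_intros)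
    also have "btl a (?d ?Z) B + (btl a (btl a ?Z B) (incl y) + btl a ?Z (?d B)) =
        btl a (btl a ?Z B) (incl y) + (btl a (?d ?Z) B + btl a ?Z (?d B))"
      by (simp only: add.left_commute)
    also have "\<dots> \<approx> btl a (btl a ?Z B) (incl y) + ?d (btl a ?Z B)"
      by (intro sym_eq_add sym_eq_refl sym_eq_sym[OF leibniz])
    finally show ?thesis unfolding b_def right_mult_btl .
  qed
  then have "sweedler (\<lambda>A B. b (right_mult a F y A) B + b A (right_mult a F y B)) Q \<approx>
      sweedler (\<lambda>A B. right_mult a F y (b A B)) Q"
    by (intro sym_eq_sweedler)
  moreover have "right_mult a F y (sweedler b Q) = sweedler (\<lambda>A B. right_mult a F y (b A B)) Q"
    by (rule plinear_sweedler_apply) (intro plinear_intros)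
  ultimately show ?thesis by (simp only: sweedler_right_mult[OF b])
qed

text \<open>The same associativity for \<odot>. The operator of \<open>bullet_extension_incl\<close>
  is a derivation of the commutative product by \<open>der_mult\<close>, and it takes the place of
  \<open>d\<close>.\<close>

lemma sweedler_bullet_right_mult:
  fixes P :: "('v, 'n, 'k) sym"
  assumes "is_bullet_extension scale a F bu"
  defines "b \<equiv> \<lambda>A B. bilinearize bu P A * B"
  shows "sweedler b (right_mult a F y Q) \<approx> right_mult a F y (sweedler b Q)"
proof -
  have bil: "sym_bilinear scale bu"
    and prod_right: "\<And>P Q y. bu P (Q * incl y) \<approx> bu (bu P Q) (incl y) - bu P (bu Q (incl y))"
    using assms(1) unfolding is_bullet_extension_def by blast+
  let ?b = "bilinearize bu" and ?d = "\<lambda>P. der_ash a y P + der_star F y P"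
  have rm: "right_mult a F y A = A * incl y + ?d A" for A
    by (simp only: right_mult_def mult.commute[of A] add.assoc)
  note cong = sym_bilinear_cong[OF bil]
  note incl = bullet_extension_incl[OF assms(1), of _ y]
  have s: "bu P Q \<approx> ?b P Q" for P Q by (rule sym_eq_bilinearize[OF bil])
  note s' = sym_eq_sym[OF s]
  have b: "pbilinear b" unfolding b_def by (intro pbilinearI plinear_intros)
  have left: "?b P (right_mult a F y A) \<approx> ?d (?b P A)" for A
  proof -
    have "?b P (right_mult a F y A) = ?b P (A * incl y) + ?b P (?d A)"
      unfolding rm by (rule plinear_add) (intro plinear_intros)
    also have "\<dots> \<approx> (bu (bu P A) (incl y) - bu P (bu A (incl y))) + bu P (?d A)"
      by (intro sym_eq_add sym_eq_trans[OF s' prod_right] s')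
    also have "\<dots> \<approx> (bu (?b P A) (incl y) - bu P (?d A)) + bu P (?d A)"
      by (intro sym_eq_add sym_eq_diff cong s incl sym_eq_refl)
    also have "\<dots> = bu (?b P A) (incl y)" by simp
    also have "\<dots> \<approx> ?d (?b P A)" by (rule incl)
    finally show ?thesis .
  qed
  have "b (right_mult a F y A) B + b A (right_mult a F y B) \<approx> right_mult a F y (b A B)" for A B
  proof -
    let ?Z = "?b P A"
    have "b (right_mult a F y A) B + b A (right_mult a F y B) \<approx>
        ?d ?Z * B + ?Z * right_mult a F y B"
      unfolding b_def by (intro sym_eq_add sym_eq_mult left sym_eq_refl)
    also have "\<dots> = right_mult a F y (?Z * B)"
      unfolding rm der_mult by (simp add: algebra_simps)
    finally show ?thesis unfolding b_def .
  qed
  then have "sweedler (\<lambda>A B. b (right_mult a F y A) B + b A (right_mult a F y B)) Q \<approx>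
      sweedler (\<lambda>A B. right_mult a F y (b A B)) Q"
    by (intro sym_eq_sweedler)
  moreover have "right_mult a F y (sweedler b Q) = sweedler (\<lambda>A B. right_mult a F y (b A B)) Q"
    by (rule plinear_sweedler_apply) (intro plinear_intros)
  ultimately show ?thesis by (simp only: sweedler_right_mult[OF b])
qed

end

section \<open>Equality of the two products\<close>

theorem proposition17:
  fixes scale :: "'k::field \<Rightarrow> 'v::ab_group_add \<Rightarrow> 'v"
    and a :: "'n::finite \<Rightarrow> 'k"
    and F :: "'n \<Rightarrow> 'v \<Rightarrow> 'v"
    and st bu :: "('v, 'n, 'k) sym \<Rightarrow> ('v, 'n, 'k) sym \<Rightarrow> ('v, 'n, 'k) sym"
  assumes "vector_space scale"
    and "\<And>i. Vector_Spaces.linear scale scale (F i)"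
    and "ga_module scale a F"
    and "is_star_extension scale a F st"
    and "is_bullet_extension scale a F bu"
  shows "\<forall>P Q. sym_eq scale (circledast a st P Q) (odot bu P Q)"
proof (intro allI)
  fix P Q
  note st = assms(4) and bu = assms(5)
  have bil: "sym_bilinear scale st" "sym_bilinear scale bu"
    and one: "sym_eq scale (st P 1) P" "sym_eq scale (bu P 1) P"
    using st bu unfolding is_star_extension_def is_bullet_extension_def by blast+
  let ?f = "\<lambda>Q. sweedler (\<lambda>A B. btl a (bilinearize st P A) B) Q"
    and ?g = "\<lambda>Q. sweedler (\<lambda>A B. bilinearize bu P A * B) Q"
  have lin: "plinear ?f" "plinear ?g" by (intro plinear_intros)+
  \<comment> \<open>That \<open>der_star F y\<close> respects the ideal is read off from
    \<open>st _ (incl y)\<close>, which it represents and which respects the ideal as part of a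
    bilinear operation.\<close>
  have right_mult_cong: "sym_eq scale (right_mult a F y A) (right_mult a F y B)"
    if "sym_eq scale A B" for y A B
  proof -
    have "sym_eq scale (der_star F y A) (der_star F y B)"
      by (rule sym_eq_trans[OF sym_eq_sym[OF star_extension_incl[OF st]]
            sym_eq_trans[OF sym_bilinear_cong[OF bil(1) that sym_eq_refl] star_extension_incl[OF st]]])
    then show ?thesis
      unfolding right_mult_btl by (intro sym_eq_add sym_eq_btl that sym_eq_refl)
  qed
  \<comment> \<open>The induction is on the degree, not on the monomial, since the two derivations
    subtracted below change monomials but keep their degree.\<close>
  have "sym_eq scale (?f (gen M)) (?g (gen M))" for M
  proof (induction "size M" arbitrary: M)
    case 0
    then have M: "gen M = (1 :: ('v, 'n, 'k) sym)" by (simp add: gen_empty)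
    have "sym_eq scale (bilinearize st P 1) P" "sym_eq scale (bilinearize bu P 1) P"
      by (rule sym_eq_trans[OF sym_eq_sym[OF sym_eq_bilinearize[OF bil(1)]] one(1)],
          rule sym_eq_trans[OF sym_eq_sym[OF sym_eq_bilinearize[OF bil(2)]] one(2)])
    then show ?case
      unfolding M sweedler_one btl_one_right mult_1_right by (rule sym_eq_trans[OF _ sym_eq_sym])
  next
    case (Suc n)
    then obtain x N where M: "M = add_mset x N" and n: "size N = n"
      by (cases M) auto
    let ?y = "gen x" and ?Q = "gen N"
    have IH: "sym_eq scale (?f (gen N')) (?g (gen N'))" if "size N' = size N" for N'
      using Suc(1)[of N'] that n by simp
    have "sym_eq scale (?f (right_mult a F ?y ?Q)) (right_mult a F ?y (?f ?Q))"
      by (rule sweedler_star_right_mult[OF st])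
    also have "sym_eq scale (right_mult a F ?y (?f ?Q)) (right_mult a F ?y (?g ?Q))"
      by (intro right_mult_cong IH refl)
    also have "sym_eq scale (right_mult a F ?y (?g ?Q)) (?g (right_mult a F ?y ?Q))"
      by (rule sym_eq_sym[OF sweedler_bullet_right_mult[OF bu]])
    finally have rm: "sym_eq scale (?f (right_mult a F ?y ?Q)) (?g (right_mult a F ?y ?Q))" .
    \<comment> \<open>Solving the definition of \<open>right_mult\<close> for its top degree term
      expresses the monomial through elements on which agreement is known.\<close>
    have gen_M: "gen M = right_mult a F ?y ?Q - der_ash a ?y ?Q - der_star F ?y ?Q"
      unfolding M right_mult_def gen_add_mset[of x N] by (simp add: incl_gen algebra_simps)
    have "sym_eq scale
        (?f (right_mult a F ?y ?Q) - ?f (der_ash a ?y ?Q) - ?f (der_star F ?y ?Q))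
        (?g (right_mult a F ?y ?Q) - ?g (der_ash a ?y ?Q) - ?g (der_star F ?y ?Q))"
      by (rule sym_eq_diff[OF sym_eq_diff[OF rm sym_eq_der_gen[OF lin IH]] sym_eq_der_gen[OF lin IH]])
    then show ?case
      by (simp only: gen_M plinear_diff[OF lin(1)] plinear_diff[OF lin(2)])
  qed
  then have "sym_eq scale (?f Q) (?g Q)"
    by (rule sym_eq_plinearI[OF lin])
  then show "sym_eq scale (circledast a st P Q) (odot bu P Q)"
    by (rule sym_eq_trans[OF circledast_bilinearize[OF bil(1)]
          sym_eq_trans[OF _ sym_eq_sym[OF odot_bilinearize[OF bil(2)]]]])
qed

end
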